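(* Let $n\ge 1$ and $f,g\in\mathrm{BW}_n$. For all $a,e,h\in\mathrm{P}[n]$ the following identities hold: 1. $$(fg)_m(a,e)=\sum f_m(a,b)\,g_m(c,d),$$ where the sum runs over all triples $(b,c,d)$ of elements of $\mathrm{P}[n]$ such that $d\subseteq e$ and $e\setminus d\subseteq a+c\subseteq b$. 2. $$(fg)_x(e,h)=\sum_{a\subseteq e,\ b,\ c,\ d\subseteq h}\gamma(a,b,c,d,e,h)\,f_x(a,b)\,g_x(c,d),$$ where the sum runs over all $a,b,c,d\in\mathrm{P}[n]$ with $a\subseteq e$ and $d\subseteq h$, and $$\gamma(a,b,c,d,e,h)=O\big\{(k_1,k_2)\ \big|\ k_1\subseteq k_2\subseteq b\cap c,\ a\cup(c\setminus k_2)=e,\ b\setminus k_1=h\setminus d\big\}.$$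
   Context: $\mathbb{Z}_2=\{0,1\}$ is the field with two elements, $[n]=\{1,\dots,n\}$, $\mathrm{P}[n]$ is the set of subsets of $[n]$; for $a,b\in\mathrm{P}[n]$, $a+b=(a\cup b)\setminus(a\cap b)$ is the symmetric difference and $\overline a=[n]\setminus a$. For a finite set $S$, $O S\in\mathbb{Z}_2$ is $1$ if $|S|$ is odd and $0$ otherwise. The Boole-Weyl algebra $\mathrm{BW}_n$ is the quotient of the free associative $\mathbb{Z}_2$-algebra $\mathbb{Z}_2\langle x_1,\dots,x_n,y_1,\dots,y_n\rangle$ by the two-sided ideal generated by $x_i^2+x_i$, $y_i^2$, $y_ix_i+x_iy_i+y_i+1$ for $i\in[n]$; $x_ix_j+x_jx_i$, $y_iy_j+y_jy_i$ for $i,j\in[n]$; and $y_ix_j+x_jy_i$ for $i\neq j\in[n]$. For $a\in\mathrm{P}[n]$ put in $\mathrm{BW}_n$: $x^a=\prod_{i\in a}x_i$, $y^a=\prod_{i\in a}y_i$, $m^a=\prod_{i\in a}x_i\prod_{i\in\overline a}(x_i+1)$ (empty products are $1$). Both $\{m^ay^b\mid a,b\in\mathrm{P}[n]\}$ and $\{x^ay^b\mid a,b\in\mathrm{P}[n]\}$ are bases of the $\mathbb{Z}_2$-vector space $\mathrm{BW}_n$, and the coordinates $f_m(a,b),f_x(a,b)\in\mathbb{Z}_2$ of $f\in\mathrm{BW}_n$ are defined by $f=\sum_{a,b}f_m(a,b)m^ay^b=\sum_{a,b}f_x(a,b)x^ay^b$. *)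

theory Defs
  imports "HOL-Algebra.Algebra" "HOL-Library.Poly_Mapping" "HOL-Library.Z2"
begin

text \<open>
  \<open>'a free_word\<close> is the free monoid over \<open>'a\<close>, written additively because the convolution
  product of \<^typ>\<open>('k, 'v) poly_mapping\<close> expects an additive monoid of keys. The monoid algebra
  \<open>'a free_word \<Rightarrow>\<^sub>0 bit\<close> is then the free associative unital algebra over the two-element
  field \<^typ>\<open>bit\<close>.
\<close>

datatype 'a free_word = Word (letters: "'a list")

instantiation free_word :: (type) monoid_add
begin

definition zero_free_word :: "'a free_word"
  where "0 = Word []"

definition plus_free_word :: "'a free_word \<Rightarrow> 'a free_word \<Rightarrow> 'a free_word"
  where "v + w = Word (letters v @ letters w)"

instance
  by standard (simp_all add: zero_free_word_def plus_free_word_def)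

end

datatype gen = GenX nat | GenY nat

type_synonym free_poly = "gen free_word \<Rightarrow>\<^sub>0 bit"

definition var :: "gen \<Rightarrow> free_poly"
  where "var u = Poly_Mapping.single (Word [u]) 1"

definition gens :: "nat \<Rightarrow> gen set"
  where "gens n = GenX ` {1..n} \<union> GenY ` {1..n}"

definition free_alg :: "nat \<Rightarrow> free_poly ring"
  where "free_alg n =
    \<lparr>carrier = {p. \<forall>w \<in> Poly_Mapping.keys p. set (letters w) \<subseteq> gens n},
     monoid.mult = (*), one = 1, ring.zero = 0, add = (+)\<rparr>"

definition bw_relations :: "nat \<Rightarrow> free_poly set"
  where "bw_relations n =
      {var (GenX i) ^ 2 + var (GenX i) | i. i \<in> {1..n}}
    \<union> {var (GenY i) ^ 2 | i. i \<in> {1..n}}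
    \<union> {var (GenY i) * var (GenX i) + var (GenX i) * var (GenY i) + var (GenY i) + 1 | i.
         i \<in> {1..n}}
    \<union> {var (GenX i) * var (GenX j) + var (GenX j) * var (GenX i) | i j. i \<in> {1..n} \<and> j \<in> {1..n}}
    \<union> {var (GenY i) * var (GenY j) + var (GenY j) * var (GenY i) | i j. i \<in> {1..n} \<and> j \<in> {1..n}}
    \<union> {var (GenY i) * var (GenX j) + var (GenX j) * var (GenY i) | i j.
         i \<in> {1..n} \<and> j \<in> {1..n} \<and> i \<noteq> j}"

definition bw_ideal :: "nat \<Rightarrow> free_poly set"
  where "bw_ideal n = genideal (free_alg n) (bw_relations n)"

definition BW :: "nat \<Rightarrow> free_poly set ring"
  where "BW n = free_alg n Quot bw_ideal n"

definition bw_class :: "nat \<Rightarrow> free_poly \<Rightarrow> free_poly set"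
  where "bw_class n p = bw_ideal n +>\<^bsub>free_alg n\<^esub> p"

text \<open>Scalar multiplication is multiplication by the image of the constant polynomial.\<close>

definition bw_scale :: "nat \<Rightarrow> bit \<Rightarrow> free_poly set \<Rightarrow> free_poly set"
  where "bw_scale n k v = bw_class n (Poly_Mapping.single 0 k) \<otimes>\<^bsub>BW n\<^esub> v"

definition bw_x :: "nat \<Rightarrow> nat \<Rightarrow> free_poly set"
  where "bw_x n i = bw_class n (var (GenX i))"

definition bw_y :: "nat \<Rightarrow> nat \<Rightarrow> free_poly set"
  where "bw_y n i = bw_class n (var (GenY i))"

text \<open>
  The factors of the products below commute, so the increasing order chosen here is immaterial;
  \<^const>\<open>finprod\<close> is not used because its theory assumes a commutative monoid.
\<close>

definition ordered_prod :: "('r, 's) monoid_scheme \<Rightarrow> (nat \<Rightarrow> 'r) \<Rightarrow> nat set \<Rightarrow> 'r"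
  where "ordered_prod R u A = foldr (\<lambda>i p. u i \<otimes>\<^bsub>R\<^esub> p) (sorted_list_of_set A) \<one>\<^bsub>R\<^esub>"

definition x_mon :: "nat \<Rightarrow> nat set \<Rightarrow> free_poly set"
  where "x_mon n a = ordered_prod (BW n) (bw_x n) a"

definition y_mon :: "nat \<Rightarrow> nat set \<Rightarrow> free_poly set"
  where "y_mon n a = ordered_prod (BW n) (bw_y n) a"

definition m_mon :: "nat \<Rightarrow> nat set \<Rightarrow> free_poly set"
  where "m_mon n a =
    ordered_prod (BW n) (bw_x n) a \<otimes>\<^bsub>BW n\<^esub>
    ordered_prod (BW n) (\<lambda>i. bw_x n i \<oplus>\<^bsub>BW n\<^esub> \<one>\<^bsub>BW n\<^esub>) ({1..n} - a)"

text \<open>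
  \<open>bw_coord n B f\<close> is the coordinate function of \<open>f\<close> in the basis of all \<open>B a \<otimes> y_mon n b\<close> with
  \<open>a, b \<subseteq> {1..n}\<close>; it is set to \<open>0\<close> at all other arguments so that it is unique as a function.
\<close>

definition bw_coord ::
    "nat \<Rightarrow> (nat set \<Rightarrow> free_poly set) \<Rightarrow> free_poly set \<Rightarrow> nat set \<Rightarrow> nat set \<Rightarrow> bit"
  where "bw_coord n B f = (THE \<phi>.
    (\<forall>a b. \<not> (a \<subseteq> {1..n} \<and> b \<subseteq> {1..n}) \<longrightarrow> \<phi> a b = 0) \<and>
    f = finsum (BW n) (\<lambda>(a, b). bw_scale n (\<phi> a b) (B a \<otimes>\<^bsub>BW n\<^esub> y_mon n b))
          (Pow {1..n} \<times> Pow {1..n}))"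

definition m_coord :: "nat \<Rightarrow> free_poly set \<Rightarrow> nat set \<Rightarrow> nat set \<Rightarrow> bit"
  where "m_coord n = bw_coord n (m_mon n)"

definition x_coord :: "nat \<Rightarrow> free_poly set \<Rightarrow> nat set \<Rightarrow> nat set \<Rightarrow> bit"
  where "x_coord n = bw_coord n (x_mon n)"

definition parity :: "'s set \<Rightarrow> bit"
  where "parity S = (if odd (card S) then 1 else 0)"

definition gamma ::
    "nat set \<Rightarrow> nat set \<Rightarrow> nat set \<Rightarrow> nat set \<Rightarrow> nat set \<Rightarrow> nat set \<Rightarrow> bit"
  where "gamma a b c d e h =
    parity {(k1, k2). k1 \<subseteq> k2 \<and> k2 \<subseteq> b \<inter> c \<and> a \<union> (c - k2) = e \<and> b - k1 = h - d}"

end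

theory Submission
  imports Defs
begin

text \<open>
  The Boole-Weyl algebra is the algebra of polynomial differential operators over the two-element
  field: it acts on functions \<open>v\<close> from subsets to \<^typ>\<open>bit\<close>, with \<open>x\<^sub>i\<close> multiplying \<open>v\<close> by the
  indicator of \<open>i \<in> s\<close> and \<open>y\<^sub>i\<close> sending \<open>v\<close> to its Boolean derivative \<open>s \<mapsto> v (s + i) + v s\<close>. The
  defining relations hold for these operators, so the action factors through the ideal
  (\<open>poly_op_bw_ideal\<close>) and yields \<open>bw_op\<close>. Here \<open>y\<^sup>b\<close> acts as the iterated derivative
  \<open>\<partial>\<^sup>b v s = (\<Sum>t \<subseteq> b. v (s + t))\<close>, \<open>x\<^sup>a\<close> as multiplication by the indicator of \<open>a \<subseteq> s\<close> and \<open>m\<^sup>a\<close> as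
  multiplication by the indicator of \<open>s = a\<close>.

  The action is faithful, and this makes both coordinate functions explicit. Testing an operator
  \<open>\<Sum>b. \<phi> s b * \<partial>\<^sup>b\<close> at \<open>s\<close> on the function \<open>r \<mapsto> [c \<subseteq> r + s]\<close> returns \<open>\<phi> s c\<close>. This reads the
  \<open>m\<close>-coordinates off the operator; the \<open>x\<close>-coordinates follow by Moebius inversion over subsets. For
  existence it is enough that the elements \<open>x\<^sup>a y\<^sup>b\<close> span, which holds because their span contains \<open>1\<close>
  and is closed under right multiplication by the generators (\<open>x_monomials_span\<close>). The expansion in the
  \<open>m\<^sup>a y\<^sup>b\<close> is then the element whose operator agrees with the given one (\<open>bw_eq_m_comb\<close>).

  Both product formulas now become computations with operators, since the operator of \<open>f g\<close> is a
  composition. For the \<open>m\<close>-coordinates, \<open>\<partial>\<^sup>b\<close> at \<open>a\<close> evaluates the second operator at the points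
  \<open>c = a + t\<close> with \<open>t \<subseteq> b\<close>, and translation by \<open>t\<close> equals \<open>\<Sum>u \<subseteq> t. \<partial>\<^sup>u\<close>; as
  \<open>\<partial>\<^sup>u \<partial>\<^sup>d\<close> is \<open>\<partial>\<close> of the union for disjoint \<open>u, d\<close> and \<open>0\<close> otherwise, the coefficient of \<open>\<partial>\<^sup>e\<close> collects the
  triples with \<open>d \<subseteq> e\<close> and \<open>e - d \<subseteq> a + c \<subseteq> b\<close> (\<open>m_coeff_mult\<close>). For the \<open>x\<close>-coordinates the
  Leibniz rule
  \<open>\<partial>\<^sup>b x\<^sup>c = (\<Sum>k1 \<subseteq> k2 \<subseteq> b \<inter> c. x\<^bsup>c - k2\<^esup> \<partial>\<^bsup>b - k1\<^esup>)\<close>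
  (\<open>bderiv_leibniz\<close>) produces exactly the pairs whose number modulo two is \<^const>\<open>gamma\<close>
  (\<open>x_coeff_mult\<close>).
\<close>

section \<open>Sums over subsets modulo two\<close>

text \<open>
  Switched off because they turn the field operations of \<^typ>\<open>bit\<close> into bit operations, out of reach of
  the ring and big-operator lemmas.
\<close>

declare add_bit_eq_xor [simp del] mult_bit_eq_and [simp del]

lemma bit_add_self [simp]: "k + k = (0::bit)"
  by (cases k) simp_all

lemma parity_eq_sum: "finite S \<Longrightarrow> parity S = (\<Sum>x\<in>S. 1)"
  by (cases "odd (card S)") (auto simp: parity_def elim!: evenE oddE)

text \<open>
  The interval between \<open>c\<close> and \<open>b\<close> is a Boolean lattice with \<open>2\<close> to the power \<open>card (b - c)\<close> elements,
  an odd number only when it is a single point.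
\<close>

lemma sum_one_interval:
  fixes c b :: "'a set"
  assumes "finite b" "c \<subseteq> b"
  shows "(\<Sum>t | c \<subseteq> t \<and> t \<subseteq> b. 1) = (of_bool (c = b) :: bit)"
proof -
  have "{t. c \<subseteq> t \<and> t \<subseteq> b} = (\<union>) c ` Pow (b - c)"
  proof (intro equalityI subsetI)
    fix t assume "t \<in> {t. c \<subseteq> t \<and> t \<subseteq> b}"
    then have "t = c \<union> (t - c)" "t - c \<in> Pow (b - c)" by auto
    then show "t \<in> (\<union>) c ` Pow (b - c)" by blast
  qed (use assms in auto)
  moreover have "inj_on ((\<union>) c) (Pow (b - c))" by (auto simp: inj_on_def)
  ultimately have "card {t. c \<subseteq> t \<and> t \<subseteq> b} = 2 ^ card (b - c)"
    using assms by (simp add: card_image card_Pow)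
  moreover have "card (b - c) = 0 \<longleftrightarrow> c = b" using assms by auto
  ultimately show ?thesis by (cases "c = b") auto
qed

text \<open>
  Modulo two the Moebius function of the subset lattice is constantly \<open>1\<close>, so summing over subsets
  is an involution.
\<close>

lemma moebius_inversion:
  fixes \<phi> :: "'a set \<Rightarrow> bit"
  assumes "finite a"
  shows "(\<Sum>s\<in>Pow a. \<Sum>c\<in>Pow s. \<phi> c) = \<phi> a"
proof -
  have fin: "finite s" if "s \<in> Pow a" for s using that assms finite_subset by auto
  have "(\<Sum>s\<in>Pow a. \<Sum>c\<in>Pow s. \<phi> c) = (\<Sum>s\<in>Pow a. \<Sum>c\<in>{c\<in>Pow a. c \<subseteq> s}. \<phi> c)"
    by (intro sum.cong) auto
  also have "\<dots> = (\<Sum>c\<in>Pow a. \<Sum>s\<in>{s\<in>Pow a. c \<subseteq> s}. \<phi> c)"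
    by (rule sum.swap_restrict) (use assms in auto)
  also have "\<dots> = (\<Sum>c\<in>Pow a. \<phi> c * (\<Sum>s | c \<subseteq> s \<and> s \<subseteq> a. 1))"
    by (intro sum.cong) (auto simp: conj_commute mult.commute)
  also have "\<dots> = (\<Sum>c\<in>Pow a. \<phi> c * of_bool (c = a))"
    using sum_one_interval[OF assms] by (intro sum.cong) auto
  also have "\<dots> = \<phi> a" using assms by simp
  finally show ?thesis .
qed

section \<open>Iterated Boolean derivatives\<close>

text \<open>
  The composition of the derivatives \<open>v \<mapsto> (\<lambda>s. v (sym_diff s {i}) + v s)\<close> for all \<open>i \<in> b\<close>, multiplied
  out: each \<open>i\<close> contributes either the translation by \<open>i\<close> or the identity.
\<close>

definition bderiv :: "'a set \<Rightarrow> ('a set \<Rightarrow> bit) \<Rightarrow> 'a set \<Rightarrow> bit"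
  where "bderiv b v s = (\<Sum>t\<in>Pow b. v (sym_diff s t))"

lemma bderiv_empty [simp]: "bderiv {} v = v"
  by (simp add: bderiv_def fun_eq_iff)

lemma bderiv_sum: "bderiv b (\<lambda>r. \<Sum>i\<in>I. k i * w i r) s = (\<Sum>i\<in>I. k i * bderiv b (w i) s)"
  unfolding bderiv_def by (subst sum.swap) (simp add: sum_distrib_left)

lemma bderiv_insert:
  assumes "finite b" "i \<notin> b"
  shows "bderiv (insert i b) v s = bderiv b v (sym_diff s {i}) + bderiv b v s"
proof -
  have inj: "inj_on (insert i) (Pow b)" using assms(2) by (auto simp: inj_on_def)
  have "bderiv (insert i b) v s =
      (\<Sum>t\<in>Pow b. v (sym_diff s t)) + (\<Sum>t\<in>insert i ` Pow b. v (sym_diff s t))"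
    unfolding bderiv_def Pow_insert using assms by (intro sum.union_disjoint) auto
  also have "(\<Sum>t\<in>insert i ` Pow b. v (sym_diff s t)) = (\<Sum>t\<in>Pow b. v (sym_diff (sym_diff s {i}) t))"
    unfolding sum.reindex[OF inj] o_def using assms(2)
    by (intro sum.cong refl arg_cong[where f = v]) auto
  finally show ?thesis by (simp add: bderiv_def add.commute)
qed

lemma sym_diff_cancel_right: "sym_diff (sym_diff s t) t = s"
  by auto

lemma bderiv_singleton: "bderiv {i} v s = v (sym_diff s {i}) + v s"
  using bderiv_insert[of "{}" i v s] by simp

lemma bderiv_translate_member:
  assumes "finite b" "i \<in> b"
  shows "bderiv b v (sym_diff s {i}) = bderiv b v s"
proof -
  have b: "b = insert i (b - {i})" "finite (b - {i})" "i \<notin> b - {i}" using assms by auto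
  show ?thesis
    apply (subst (1 2) b(1))
    apply (subst (1 2) bderiv_insert[OF b(2,3)])
    apply (simp only: sym_diff_cancel_right add.commute)
    done
qed

text \<open>
  Taylor's formula: the translation by \<open>i\<close> is the identity plus the derivative in direction \<open>i\<close>, and
  these factors are multiplied out over \<open>i \<in> t\<close>. In terms of sums it is Moebius inversion of the
  definition of \<^const>\<open>bderiv\<close>.
\<close>

lemma translate_eq_sum_bderiv:
  assumes "finite t"
  shows "v (sym_diff s t) = (\<Sum>u\<in>Pow t. bderiv u v s)"
  unfolding bderiv_def using moebius_inversion[OF assms, of "\<lambda>t. v (sym_diff s t)"] by simp

text \<open>
  Repeating a direction gives zero, because a derivative in direction \<open>i\<close> no longer depends on whether
  \<open>i\<close> belongs to the argument.
\<close>

lemma bderiv_bderiv: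
  assumes "finite b" "finite d"
  shows "bderiv b (bderiv d v) s = of_bool (b \<inter> d = {}) * bderiv (b \<union> d) v s"
  using assms(1)
proof (induction b arbitrary: s)
  case (insert i b)
  have fin: "finite (b \<union> d)" using insert assms by auto
  have *: "bderiv (insert i b) (bderiv d v) s =
      of_bool (b \<inter> d = {}) * (bderiv (b \<union> d) v (sym_diff s {i}) + bderiv (b \<union> d) v s)"
    by (subst bderiv_insert[OF insert(1,2)], subst (1 2) insert.IH) (simp only: distrib_left)
  show ?case
  proof (cases "i \<in> d")
    case True
    then show ?thesis using * bderiv_translate_member[OF fin, of i v s] by simp
  next
    case False
    then show ?thesis using * bderiv_insert[OF fin, of i v s] insert(2) by simp
  qed
qed simp

text \<open>
  The index set of the Leibniz rule. Each element of \<open>A\<close> is in one of three states: outside \<open>k2\<close>, in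
  \<open>k2\<close> only, or in \<open>k1\<close>. They are the three terms of the relation \<open>y x = x y + y + 1\<close>, in this order.
\<close>

definition nested_pairs :: "'a set \<Rightarrow> ('a set \<times> 'a set) set"
  where "nested_pairs A = {(k1, k2). k1 \<subseteq> k2 \<and> k2 \<subseteq> A}"

lemma finite_nested_pairs [simp]: "finite A \<Longrightarrow> finite (nested_pairs A)"
  unfolding nested_pairs_def
  by (rule finite_subset[of _ "Pow A \<times> Pow A"]) auto

lemma sum_nested_pairs_insert:
  assumes "finite A" "i \<notin> A"
  shows "(\<Sum>k\<in>nested_pairs (insert i A). F (fst k) (snd k)) =
    (\<Sum>k\<in>nested_pairs A. F (fst k) (snd k) + F (fst k) (insert i (snd k))
       + F (insert i (fst k)) (insert i (snd k)))"
proof -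
  let ?N = "nested_pairs A"
  let ?p = "\<lambda>k. (fst k, insert i (snd k))" and ?q = "\<lambda>k. (insert i (fst k), insert i (snd k))"
  have split: "nested_pairs (insert i A) = ?N \<union> ?p ` ?N \<union> ?q ` ?N" (is "?L = ?R")
  proof (intro equalityI subsetI)
    fix k assume "k \<in> ?L"
    then obtain k1 k2 where k: "k = (k1, k2)" "k1 \<subseteq> k2" "k2 \<subseteq> insert i A"
      by (auto simp: nested_pairs_def)
    let ?k = "(k1 - {i}, k2 - {i})"
    have N: "?k \<in> ?N" using k by (auto simp: nested_pairs_def)
    consider "k = ?k" | "k = ?p ?k" | "k = ?q ?k"
      using k by fastforce
    then show "k \<in> ?R" using N by cases blast+
  qed (auto simp: nested_pairs_def)
  have inj: "inj_on ?p ?N" "inj_on ?q ?N"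
    using assms(2) unfolding inj_on_def nested_pairs_def by (auto simp: insert_ident subset_iff) 
  have "(\<Sum>k\<in>nested_pairs (insert i A). F (fst k) (snd k)) =
     (\<Sum>k\<in>?N. F (fst k) (snd k)) + (\<Sum>k\<in>?p ` ?N. F (fst k) (snd k)) + (\<Sum>k\<in>?q ` ?N. F (fst k) (snd k))"
  proof -
    have "finite ?N" using assms(1) by simp
    moreover have "?N \<inter> ?p ` ?N = {}" "(?N \<union> ?p ` ?N) \<inter> ?q ` ?N = {}"
      using assms(2) by (auto simp: nested_pairs_def)
    ultimately show ?thesis unfolding split by (simp add: sum.union_disjoint)
  qed
  then show ?thesis
    by (simp add: sum.reindex[OF inj(1)] sum.reindex[OF inj(2)] sum.distrib o_def case_prod_beta)
qed

text \<open>
  By induction on \<open>b\<close>, moving one further derivative past the monomial: in a direction \<open>i \<notin> c\<close> it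
  commutes with the monomial, and for \<open>i \<in> c\<close> the relation \<open>y x = x y + y + 1\<close> splits each term into the three
  terms of \<open>sum_nested_pairs_insert\<close>.
\<close>

lemma bderiv_leibniz:
  assumes "finite b"
  shows "bderiv b (\<lambda>r. of_bool (c \<subseteq> r) * w r) s =
    (\<Sum>k\<in>nested_pairs (b \<inter> c). of_bool (c - snd k \<subseteq> s) * bderiv (b - fst k) w s)"
  using assms
proof (induction b arbitrary: s)
  case empty
  have "nested_pairs {} = {({}, {} :: 'a set)}" by (auto simp: nested_pairs_def)
  then show ?case by simp
next
  case (insert i b)
  let ?T = "\<lambda>s. bderiv b (\<lambda>r. of_bool (c \<subseteq> r) * w r) s"
  have step: "bderiv (insert i b) (\<lambda>r. of_bool (c \<subseteq> r) * w r) s = ?T (sym_diff s {i}) + ?T s"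
    by (rule bderiv_insert[OF insert(1,2)])
  have k_subset: "i \<notin> fst k" "i \<notin> snd k" if "k \<in> nested_pairs (b \<inter> c)" for k
    using that insert(2) by (auto simp: nested_pairs_def)
  have D: "bderiv (insert i (b - fst k)) w s = bderiv (b - fst k) w (sym_diff s {i}) + bderiv (b - fst k) w s" for k :: "'a set \<times> 'a set"
    using insert(1,2) by (intro bderiv_insert) auto
  show ?case
  proof (cases "i \<in> c")
    case False
    have "of_bool (c - snd k \<subseteq> sym_diff s {i}) * bderiv (b - fst k) w (sym_diff s {i})
        + of_bool (c - snd k \<subseteq> s) * bderiv (b - fst k) w s
      = of_bool (c - snd k \<subseteq> s) * bderiv (insert i b - fst k) w s" if "k \<in> nested_pairs (b \<inter> c)" for k
    proof -
      have "insert i b - fst k = insert i (b - fst k)" using k_subset[OF that] by auto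
      moreover have "c - snd k \<subseteq> sym_diff s {i} \<longleftrightarrow> c - snd k \<subseteq> s" using False by auto
      ultimately show ?thesis by (simp add: D distrib_left del: insert_Diff_single)
    qed
    moreover have "insert i b \<inter> c = b \<inter> c" using False by auto
    ultimately show ?thesis unfolding step insert.IH sum.distrib[symmetric] by (auto intro!: sum.cong)
  next
    case True
    have "of_bool (c - snd k \<subseteq> sym_diff s {i}) * bderiv (b - fst k) w (sym_diff s {i})
        + of_bool (c - snd k \<subseteq> s) * bderiv (b - fst k) w s
      = of_bool (c - snd k \<subseteq> s) * bderiv (insert i b - fst k) w s
        + of_bool (c - insert i (snd k) \<subseteq> s) * bderiv (insert i b - fst k) w s
        + of_bool (c - insert i (snd k) \<subseteq> s) * bderiv (insert i b - insert i (fst k)) w s"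
      if "k \<in> nested_pairs (b \<inter> c)" for k
    proof -
      let ?A = "c - insert i (snd k) \<subseteq> s"
      have "insert i b - fst k = insert i (b - fst k)" "insert i b - insert i (fst k) = b - fst k"
        using k_subset[OF that] insert(2) by auto
      moreover have "c - snd k \<subseteq> sym_diff s {i} \<longleftrightarrow> ?A \<and> i \<notin> s" "c - snd k \<subseteq> s \<longleftrightarrow> ?A \<and> i \<in> s"
        using True k_subset[OF that] by auto
      ultimately show ?thesis
        by (cases ?A; cases "i \<in> s") (simp_all add: D add_ac del: insert_Diff_single)
    qed
    note summand = this
    have index: "insert i b \<inter> c = insert i (b \<inter> c)" "i \<notin> b \<inter> c" "finite (b \<inter> c)"
      using True insert(1,2) by auto
    show ?thesis
      unfolding step insert.IH sum.distrib[symmetric] index(1)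
        sum_nested_pairs_insert[OF index(3,2), where F = "\<lambda>k1 k2. of_bool (c - k2 \<subseteq> s) * bderiv (insert i b - k1) w s"]
      by (intro sum.cong refl summand)
  qed
qed

section \<open>The action of the free algebra on Boolean functions\<close>

fun gen_op :: "gen \<Rightarrow> (nat set \<Rightarrow> bit) \<Rightarrow> nat set \<Rightarrow> bit"
  where
    "gen_op (GenX i) v = (\<lambda>s. of_bool (i \<in> s) * v s)"
  | "gen_op (GenY i) v = bderiv {i} v"

definition word_op :: "gen free_word \<Rightarrow> (nat set \<Rightarrow> bit) \<Rightarrow> nat set \<Rightarrow> bit"
  where "word_op w = foldr gen_op (letters w)"

definition poly_op :: "free_poly \<Rightarrow> (nat set \<Rightarrow> bit) \<Rightarrow> nat set \<Rightarrow> bit"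
  where "poly_op p v s = (\<Sum>w\<in>Poly_Mapping.keys p. Poly_Mapping.lookup p w * word_op w v s)"

lemma gen_op_sum: "gen_op u (\<lambda>r. \<Sum>i\<in>I. k i * w i r) s = (\<Sum>i\<in>I. k i * gen_op u (w i) s)"
  by (cases u) (simp_all add: bderiv_sum sum_distrib_left mult_ac)

lemma word_op_sum:
  "word_op z (\<lambda>r. \<Sum>i\<in>I. k i * w i r) = (\<lambda>s. \<Sum>i\<in>I. k i * word_op z (w i) s)"
proof -
  have "foldr gen_op l (\<lambda>r. \<Sum>i\<in>I. k i * w i r) = (\<lambda>s. \<Sum>i\<in>I. k i * foldr gen_op l (w i) s)" for l
  proof (induction l)
    case (Cons u l)
    show ?case by (simp add: Cons.IH gen_op_sum fun_eq_iff)
  qed simp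
  then show ?thesis by (simp add: word_op_def)
qed

lemma word_op_zero [simp]: "word_op 0 v = v"
  by (simp add: word_op_def zero_free_word_def)

lemma word_op_plus [simp]: "word_op (w + z) v = word_op w (word_op z v)"
  by (simp add: word_op_def plus_free_word_def)

lemma poly_op_eq_sum:
  assumes "finite W" "Poly_Mapping.keys p \<subseteq> W"
  shows "poly_op p v s = (\<Sum>w\<in>W. Poly_Mapping.lookup p w * word_op w v s)"
  unfolding poly_op_def using assms
  by (intro sum.mono_neutral_left) (auto simp: in_keys_iff)

lemma poly_op_add: "poly_op (p + q) v s = poly_op p v s + poly_op q v s"
proof -
  let ?W = "Poly_Mapping.keys p \<union> Poly_Mapping.keys q"
  have "finite ?W" "Poly_Mapping.keys (p + q) \<subseteq> ?W" by (auto simp: keys_add)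
  then show ?thesis
    using poly_op_eq_sum[of ?W "p + q"] poly_op_eq_sum[of ?W p] poly_op_eq_sum[of ?W q]
    by (simp add: lookup_add distrib_right sum.distrib)
qed

lemma poly_op_zero [simp]: "poly_op 0 v s = 0"
  by (simp add: poly_op_def)

lemma poly_op_sum: "poly_op (\<Sum>i\<in>I. p i) v s = (\<Sum>i\<in>I. poly_op (p i) v s)"
  by (induction I rule: infinite_finite_induct) (simp_all add: poly_op_add)

lemma poly_op_single [simp]: "poly_op (Poly_Mapping.single w k) v s = k * word_op w v s"
  by (simp add: poly_op_def)

lemma poly_op_one [simp]: "poly_op 1 v s = v s"
  using poly_op_single[of 0 1 v s] by (simp del: poly_op_single)

lemma sum_monomials:
  "(\<Sum>w\<in>Poly_Mapping.keys p. Poly_Mapping.single w (Poly_Mapping.lookup p w)) = p"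
  by (intro poly_mapping_eqI)
    (auto simp: lookup_sum lookup_single when_def in_keys_iff)

lemma poly_op_mult: "poly_op (p * q) v s = poly_op p (poly_op q v) s"
proof -
  let ?P = "Poly_Mapping.keys p" and ?Q = "Poly_Mapping.keys q"
  let ?p = "Poly_Mapping.lookup p" and ?q = "Poly_Mapping.lookup q"
  have "p * q = (\<Sum>w\<in>?P. \<Sum>z\<in>?Q. Poly_Mapping.single (w + z) (?p w * ?q z))"
    by (subst sum_monomials[of p, symmetric], subst sum_monomials[of q, symmetric])
      (simp only: sum_product mult_single)
  then have "poly_op (p * q) v s = (\<Sum>w\<in>?P. \<Sum>z\<in>?Q. ?p w * ?q z * word_op w (word_op z v) s)"
    by (simp add: poly_op_sum)
  also have "\<dots> = poly_op p (poly_op q v) s"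
    unfolding poly_op_def[of p] poly_op_def[of q, abs_def]
    by (simp only: word_op_sum sum_distrib_left mult.assoc)
  finally show ?thesis .
qed

lemma poly_op_var [simp]: "poly_op (var u) v s = gen_op u v s"
  by (simp add: var_def word_op_def)

lemma free_alg_simps [simp]:
  "monoid.mult (free_alg n) = (*)" "one (free_alg n) = 1" "ring.zero (free_alg n) = 0" "add (free_alg n) = (+)"
  by (simp_all add: free_alg_def)

lemma carrier_free_alg:
  "p \<in> carrier (free_alg n) \<longleftrightarrow> (\<forall>w\<in>Poly_Mapping.keys p. set (letters w) \<subseteq> gens n)"
  by (simp add: free_alg_def)

lemma free_alg_closed:
  assumes "p \<in> carrier (free_alg n)" "q \<in> carrier (free_alg n)"
  shows "p + q \<in> carrier (free_alg n)" "p * q \<in> carrier (free_alg n)"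
proof -
  show "p + q \<in> carrier (free_alg n)"
    using assms keys_add[of p q] unfolding carrier_free_alg by blast
  show "p * q \<in> carrier (free_alg n)"
    unfolding carrier_free_alg
  proof
    fix w assume "w \<in> Poly_Mapping.keys (p * q)"
    then obtain y z where "w = y + z" "y \<in> Poly_Mapping.keys p" "z \<in> Poly_Mapping.keys q"
      using keys_mult[of p q] by blast
    then show "set (letters w) \<subseteq> gens n"
      using assms unfolding carrier_free_alg by (simp add: plus_free_word_def)
  qed
qed

lemma free_alg_one [simp]: "1 \<in> carrier (free_alg n)" and free_alg_zero [simp]: "0 \<in> carrier (free_alg n)"
  and free_alg_var: "u \<in> gens n \<Longrightarrow> var u \<in> carrier (free_alg n)"
  by (auto simp: carrier_free_alg zero_free_word_def var_def)

lemma free_poly_add_self [simp]: "p + p = (0 :: free_poly)"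
  by (intro poly_mapping_eqI) (simp add: lookup_add)

lemma ring_free_alg: "ring (free_alg n)"
proof (rule ringI)
  show "abelian_group (free_alg n)"
  proof (rule abelian_groupI)
    fix p assume "p \<in> carrier (free_alg n)"
    then show "\<exists>q\<in>carrier (free_alg n). q \<oplus>\<^bsub>free_alg n\<^esub> p = \<zero>\<^bsub>free_alg n\<^esub>"
      by (intro bexI[of _ p]) simp_all
  qed (simp_all add: free_alg_closed add_ac)
  show "Group.monoid (free_alg n)"
    by (rule monoidI) (simp_all add: free_alg_closed mult.assoc)
qed (simp_all add: distrib_left distrib_right)

lemma bw_relations_closed: "bw_relations n \<subseteq> carrier (free_alg n)"
proof -
  have "var (GenX i) \<in> carrier (free_alg n)" "var (GenY i) \<in> carrier (free_alg n)"
    if "i \<in> {1..n}" for i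
    using that by (auto intro!: free_alg_var simp: gens_def)
  then show ?thesis
    unfolding bw_relations_def power2_eq_square
    by (intro subsetI; elim UnE CollectE exE conjE; clarify)
      (intro free_alg_closed free_alg_one; assumption)+
qed

lemma ideal_bw_ideal: "ideal (bw_ideal n) (free_alg n)"
  unfolding bw_ideal_def by (rule ring.genideal_ideal[OF ring_free_alg bw_relations_closed])

text \<open>
  The relation between \<open>y\<^sub>i\<close> and \<open>x\<^sub>i\<close> is the twisted product rule: translating by \<open>i\<close> complements the
  membership of \<open>i\<close>. In all other mixed relations the translation leaves the indicator unchanged.
\<close>

lemma poly_op_relation:
  assumes "p \<in> bw_relations n"
  shows "poly_op p v s = 0"
proof -
  \<comment> \<open>Translation by \<open>i\<close> is kept opaque, since unfolded symmetric differences have no normal form.\<close>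
  define flip where "flip i s = sym_diff s {i}" for i :: nat and s
  have flip_flip: "flip i (flip i s) = s" for i s by (auto simp: flip_def)
  have flip_commute: "flip i (flip j s) = flip j (flip i s)" for i j s by (auto simp: flip_def)
  have mem_flip: "j \<in> flip i s \<longleftrightarrow> (if i = j then j \<notin> s else j \<in> s)" for i j s
    by (auto simp: flip_def)
  have op_y: "gen_op (GenY i) v = (\<lambda>s. v (flip i s) + v s)" for i v
    by (simp add: fun_eq_iff bderiv_singleton flip_def)
  note ops = poly_op_add poly_op_mult poly_op_one poly_op_var gen_op.simps(1) op_y
  show ?thesis
    using assms unfolding bw_relations_def power2_eq_square
    apply (elim UnE CollectE exE conjE)
         apply (simp_all del: gen_op.simps add: ops flip_flip mem_flip)
       apply (simp_all add: flip_commute add_ac mult_ac distrib_left)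
    done
qed

lemma poly_op_zero_function [simp]: "poly_op p (\<lambda>_. 0) s = 0"
  using word_op_sum[where I = "{}"] by (simp add: poly_op_def)

text \<open>
  The polynomials acting as zero form an ideal that contains the relations, hence also the ideal they
  generate.
\<close>

lemma poly_op_bw_ideal:
  assumes "p \<in> bw_ideal n"
  shows "poly_op p v s = 0"
proof -
  interpret ring "free_alg n" by (rule ring_free_alg)
  let ?K = "{p \<in> carrier (free_alg n). \<forall>v s. poly_op p v s = 0}"
  have "ideal ?K (free_alg n)"
  proof (rule idealI)
    have "\<ominus>\<^bsub>free_alg n\<^esub> p = p" if "p \<in> carrier (free_alg n)" for p
      using that by (intro minus_equality) auto
    then show "subgroup ?K (add_monoid (free_alg n))"
      by (intro add.subgroupI)
        (auto simp: free_alg_closed poly_op_add a_inv_def[symmetric])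
  next
    fix p q assume p: "p \<in> ?K" and q: "q \<in> carrier (free_alg n)"
    have "poly_op p v = (\<lambda>_. 0)" for v using p by (simp add: fun_eq_iff)
    then show "q \<otimes>\<^bsub>free_alg n\<^esub> p \<in> ?K" "p \<otimes>\<^bsub>free_alg n\<^esub> q \<in> ?K"
      using p q by (simp_all add: free_alg_closed poly_op_mult)
  qed (rule ring_free_alg)
  then have "bw_ideal n \<subseteq> ?K"
    unfolding bw_ideal_def using bw_relations_closed poly_op_relation
    by (intro genideal_minimal) auto
  then show ?thesis using assms by auto
qed

section \<open>The quotient and its action\<close>

lemma ring_BW: "ring (BW n)"
  unfolding BW_def by (rule ideal.quotient_is_ring[OF ideal_bw_ideal])

lemma bw_class_hom: "bw_class n \<in> ring_hom (free_alg n) (BW n)"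
  using ideal.rcos_ring_hom[OF ideal_bw_ideal, of n] unfolding BW_def bw_class_def .

lemmas bw_class_closed = ring_hom_closed[OF bw_class_hom]

lemma bw_class_mult:
  "p \<in> carrier (free_alg n) \<Longrightarrow> q \<in> carrier (free_alg n) \<Longrightarrow>
    bw_class n p \<otimes>\<^bsub>BW n\<^esub> bw_class n q = bw_class n (p * q)"
  using ring_hom_mult[OF bw_class_hom] by simp

lemma bw_class_add:
  "p \<in> carrier (free_alg n) \<Longrightarrow> q \<in> carrier (free_alg n) \<Longrightarrow>
    bw_class n p \<oplus>\<^bsub>BW n\<^esub> bw_class n q = bw_class n (p + q)"
  using ring_hom_add[OF bw_class_hom] by simp

lemma bw_class_one: "bw_class n 1 = \<one>\<^bsub>BW n\<^esub>"
  using ring_hom_one[OF bw_class_hom] by simp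

lemma bw_class_ideal:
  assumes "p \<in> bw_ideal n"
  shows "bw_class n p = \<zero>\<^bsub>BW n\<^esub>"
  using ring.a_rcos_zero[OF ring_free_alg ideal_bw_ideal assms]
  by (simp add: bw_class_def BW_def FactRing_def)

lemma bw_class_zero: "bw_class n 0 = \<zero>\<^bsub>BW n\<^esub>"
  using additive_subgroup.zero_closed[OF ideal.axioms(1)[OF ideal_bw_ideal]]
  by (intro bw_class_ideal) simp

lemma BW_cases:
  assumes "f \<in> carrier (BW n)"
  obtains p where "p \<in> carrier (free_alg n)" "f = bw_class n p"
  using assms by (auto simp: BW_def bw_class_def FactRing_def A_RCOSETS_def' a_r_coset_def')

text \<open>
  Characteristic two, so that signs can be disregarded in the quotient as well.
\<close>

lemma bw_add_self:
  assumes "f \<in> carrier (BW n)"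
  shows "f \<oplus>\<^bsub>BW n\<^esub> f = \<zero>\<^bsub>BW n\<^esub>"
  using assms by (elim BW_cases) (simp add: bw_class_add bw_class_zero)

lemma bw_class_eqI:
  assumes "p \<in> carrier (free_alg n)" "q \<in> carrier (free_alg n)" "p + q \<in> bw_relations n"
  shows "bw_class n p = bw_class n q"
proof -
  interpret ring "BW n" by (rule ring_BW)
  have closed: "bw_class n p \<in> carrier (BW n)" "bw_class n q \<in> carrier (BW n)"
    using assms by (simp_all add: bw_class_closed)
  have "p + q \<in> bw_ideal n"
    using ring.genideal_self[OF ring_free_alg bw_relations_closed] assms(3)
    unfolding bw_ideal_def by blast
  then have "bw_class n p \<oplus>\<^bsub>BW n\<^esub> bw_class n q = bw_class n q \<oplus>\<^bsub>BW n\<^esub> bw_class n q"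
    using assms closed by (simp add: bw_class_add bw_class_ideal bw_class_zero)
  then show ?thesis using closed by simp
qed

text \<open>
  Any representative of the coset acts in the same way (\<open>bw_op_class\<close>), so the choice is
  harmless.
\<close>

definition bw_op :: "free_poly set \<Rightarrow> (nat set \<Rightarrow> bit) \<Rightarrow> nat set \<Rightarrow> bit"
  where "bw_op f = poly_op (SOME p. p \<in> f)"

lemma bw_op_class [simp]:
  assumes "p \<in> carrier (free_alg n)"
  shows "bw_op (bw_class n p) v s = poly_op p v s"
proof -
  interpret ideal "bw_ideal n" "free_alg n" by (rule ideal_bw_ideal)
  have "p \<in> bw_class n p" using a_rcos_self assms by (simp add: bw_class_def)
  then have "(SOME q. q \<in> bw_class n p) \<in> bw_class n p" by (rule someI)
  then obtain q where "q \<in> bw_ideal n" "(SOME q. q \<in> bw_class n p) = q + p"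
    by (auto simp: bw_class_def a_r_coset_def' )
  then show ?thesis by (simp add: bw_op_def poly_op_add poly_op_bw_ideal)
qed

lemma bw_op_mult:
  assumes "f \<in> carrier (BW n)" "g \<in> carrier (BW n)"
  shows "bw_op (f \<otimes>\<^bsub>BW n\<^esub> g) v = bw_op f (bw_op g v)"
proof -
  obtain p q where pq: "p \<in> carrier (free_alg n)" "f = bw_class n p"
      "q \<in> carrier (free_alg n)" "g = bw_class n q"
    using assms by (elim BW_cases)
  then have g: "bw_op g v = poly_op q v" by (simp add: fun_eq_iff)
  show ?thesis unfolding g using pq by (simp add: fun_eq_iff bw_class_mult free_alg_closed poly_op_mult)
qed

lemma bw_op_add:
  assumes "f \<in> carrier (BW n)" "g \<in> carrier (BW n)"
  shows "bw_op (f \<oplus>\<^bsub>BW n\<^esub> g) v s = bw_op f v s + bw_op g v s"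
  using assms by (elim BW_cases) (simp add: bw_class_add free_alg_closed poly_op_add)

lemma bw_op_one [simp]: "bw_op \<one>\<^bsub>BW n\<^esub> v = v"
  unfolding bw_class_one[symmetric] by (simp add: fun_eq_iff)

lemma bw_op_zero [simp]: "bw_op \<zero>\<^bsub>BW n\<^esub> v s = 0"
  unfolding bw_class_zero[symmetric] by simp

lemma bw_op_finsum:
  assumes "finite A" "F \<in> A \<rightarrow> carrier (BW n)"
  shows "bw_op (finsum (BW n) F A) v s = (\<Sum>x\<in>A. bw_op (F x) v s)"
proof -
  interpret ring "BW n" by (rule ring_BW)
  show ?thesis using assms
  proof (induction A)
    case (insert x A)
    then show ?case by (simp add: finsum_insert bw_op_add Pi_def)
  qed simp
qed

lemma bw_x_closed: "i \<in> {1..n} \<Longrightarrow> bw_x n i \<in> carrier (BW n)"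
  and bw_y_closed: "i \<in> {1..n} \<Longrightarrow> bw_y n i \<in> carrier (BW n)"
  by (simp_all add: bw_x_def bw_y_def bw_class_closed free_alg_var gens_def)

lemma var_closed:
  assumes "i \<in> {1..n}"
  shows "var (GenX i) \<in> carrier (free_alg n)" "var (GenY i) \<in> carrier (free_alg n)"
  using assms by (simp_all add: free_alg_var gens_def)

lemma bw_op_x: "i \<in> {1..n} \<Longrightarrow> bw_op (bw_x n i) v = (\<lambda>s. of_bool (i \<in> s) * v s)"
  and bw_op_y: "i \<in> {1..n} \<Longrightarrow> bw_op (bw_y n i) v = bderiv {i} v"
  by (simp_all add: bw_x_def bw_y_def var_closed fun_eq_iff)

lemma bw_generator_relations:
  assumes i: "i \<in> {1..n}" and j: "j \<in> {1..n}"
  shows bw_x_idem: "bw_x n i \<otimes>\<^bsub>BW n\<^esub> bw_x n i = bw_x n i"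
    and bw_y_square: "bw_y n i \<otimes>\<^bsub>BW n\<^esub> bw_y n i = \<zero>\<^bsub>BW n\<^esub>"
    and bw_x_commute: "bw_x n i \<otimes>\<^bsub>BW n\<^esub> bw_x n j = bw_x n j \<otimes>\<^bsub>BW n\<^esub> bw_x n i"
    and bw_y_commute: "bw_y n i \<otimes>\<^bsub>BW n\<^esub> bw_y n j = bw_y n j \<otimes>\<^bsub>BW n\<^esub> bw_y n i"
    and bw_y_x_commute: "i \<noteq> j \<Longrightarrow> bw_y n i \<otimes>\<^bsub>BW n\<^esub> bw_x n j = bw_x n j \<otimes>\<^bsub>BW n\<^esub> bw_y n i"
    and bw_y_x_same: "bw_y n i \<otimes>\<^bsub>BW n\<^esub> bw_x n i =
      bw_x n i \<otimes>\<^bsub>BW n\<^esub> bw_y n i \<oplus>\<^bsub>BW n\<^esub> (bw_y n i \<oplus>\<^bsub>BW n\<^esub> \<one>\<^bsub>BW n\<^esub>)"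
proof -
  note closed = var_closed[OF i] var_closed[OF j] free_alg_closed free_alg_one free_alg_zero
  let ?x = "\<lambda>i. var (GenX i)" and ?y = "\<lambda>i. var (GenY i)"
  have "?x i * ?x i + ?x i \<in> bw_relations n" "?y i * ?y i + 0 \<in> bw_relations n"
    "?x i * ?x j + ?x j * ?x i \<in> bw_relations n" "?y i * ?y j + ?y j * ?y i \<in> bw_relations n"
    "i \<noteq> j \<Longrightarrow> ?y i * ?x j + ?x j * ?y i \<in> bw_relations n"
    "?y i * ?x i + (?x i * ?y i + (?y i + 1)) \<in> bw_relations n"
    unfolding bw_relations_def power2_eq_square add.assoc[symmetric] add_0_right
    using i j by blast+
  note rel = this
  have "bw_class n (?x i * ?x i) = bw_class n (?x i)"
    by (rule bw_class_eqI) (simp_all only: rel closed)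
  moreover have "bw_class n (?y i * ?y i) = bw_class n 0"
    by (rule bw_class_eqI) (simp_all only: rel closed)
  moreover have "bw_class n (?x i * ?x j) = bw_class n (?x j * ?x i)"
    by (rule bw_class_eqI) (simp_all only: rel closed)
  moreover have "bw_class n (?y i * ?y j) = bw_class n (?y j * ?y i)"
    by (rule bw_class_eqI) (simp_all only: rel closed)
  moreover have "bw_class n (?y i * ?x j) = bw_class n (?x j * ?y i)" if "i \<noteq> j"
    by (rule bw_class_eqI) (simp_all only: rel(5)[OF that] closed)
  moreover have "bw_class n (?y i * ?x i) = bw_class n (?x i * ?y i + (?y i + 1))"
    by (rule bw_class_eqI) (simp_all only: rel closed)
  ultimately show "bw_x n i \<otimes>\<^bsub>BW n\<^esub> bw_x n i = bw_x n i"
    "bw_y n i \<otimes>\<^bsub>BW n\<^esub> bw_y n i = \<zero>\<^bsub>BW n\<^esub>"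
    "bw_x n i \<otimes>\<^bsub>BW n\<^esub> bw_x n j = bw_x n j \<otimes>\<^bsub>BW n\<^esub> bw_x n i"
    "bw_y n i \<otimes>\<^bsub>BW n\<^esub> bw_y n j = bw_y n j \<otimes>\<^bsub>BW n\<^esub> bw_y n i"
    "i \<noteq> j \<Longrightarrow> bw_y n i \<otimes>\<^bsub>BW n\<^esub> bw_x n j = bw_x n j \<otimes>\<^bsub>BW n\<^esub> bw_y n i"
    "bw_y n i \<otimes>\<^bsub>BW n\<^esub> bw_x n i =
      bw_x n i \<otimes>\<^bsub>BW n\<^esub> bw_y n i \<oplus>\<^bsub>BW n\<^esub> (bw_y n i \<oplus>\<^bsub>BW n\<^esub> \<one>\<^bsub>BW n\<^esub>)"
    unfolding bw_x_def bw_y_def bw_class_one[symmetric] bw_class_zero[symmetric]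
    by (simp_all add: bw_class_mult bw_class_add closed)
qed

section \<open>Ordered products and the operators of monomials\<close>

context monoid
begin

lemma ordered_prod_closed:
  assumes "finite A" "\<And>i. i \<in> A \<Longrightarrow> u i \<in> carrier G"
  shows "ordered_prod G u A \<in> carrier G"
proof -
  have "foldr (\<lambda>i p. u i \<otimes> p) l \<one> \<in> carrier G" if "set l \<subseteq> A" for l
    using that assms(2) by (induction l) auto
  then show ?thesis using assms(1) by (simp add: ordered_prod_def)
qed

lemma ordered_prod_empty [simp]: "ordered_prod G u {} = \<one>"
  by (simp add: ordered_prod_def)

lemma ordered_prod_commute:
  assumes "finite A" "\<And>i. i \<in> A \<Longrightarrow> u i \<in> carrier G" "z \<in> carrier G"
    and "\<And>i. i \<in> A \<Longrightarrow> u i \<otimes> z = z \<otimes> u i"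
  shows "ordered_prod G u A \<otimes> z = z \<otimes> ordered_prod G u A"
proof -
  have "foldr (\<lambda>i p. u i \<otimes> p) l \<one> \<in> carrier G \<and>
      foldr (\<lambda>i p. u i \<otimes> p) l \<one> \<otimes> z = z \<otimes> foldr (\<lambda>i p. u i \<otimes> p) l \<one>"
    if "set l \<subseteq> A" for l
    using that
  proof (induction l)
    case (Cons i l)
    then have "u i \<in> carrier G" "u i \<otimes> z = z \<otimes> u i" using assms(2,4) by auto
    then show ?case using Cons assms(3) by simp (metis m_assoc)
  qed (use assms(3) in simp)
  then show ?thesis using assms(1) by (simp add: ordered_prod_def)
qed

lemma ordered_prod_insert:
  assumes "finite A" "i \<notin> A" "\<And>j. j \<in> insert i A \<Longrightarrow> u j \<in> carrier G"
    and "\<And>j. j \<in> A \<Longrightarrow> u j \<otimes> u i = u i \<otimes> u j"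
  shows "ordered_prod G u (insert i A) = u i \<otimes> ordered_prod G u A"
proof -
  have "foldr (\<lambda>i p. u i \<otimes> p) l \<one> \<in> carrier G \<and>
      foldr (\<lambda>i p. u i \<otimes> p) (insort i l) \<one> = u i \<otimes> foldr (\<lambda>i p. u i \<otimes> p) l \<one>"
    if "set l \<subseteq> A" for l
    using that
  proof (induction l)
    case (Cons j l)
    then have "u j \<in> carrier G" "u i \<in> carrier G" "u j \<otimes> u i = u i \<otimes> u j"
      using assms(3,4) by auto
    then show ?case using Cons by simp (metis m_assoc)
  qed simp
  then show ?thesis
    using assms(1,2) by (simp add: ordered_prod_def sorted_list_of_set_insert_remove)
qed

end

lemma bw_op_ordered_prod:
  assumes "finite A" "\<And>i. i \<in> A \<Longrightarrow> u i \<in> carrier (BW n)"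
  shows "bw_op (ordered_prod (BW n) u A) v = foldr (\<lambda>i. bw_op (u i)) (sorted_list_of_set A) v"
proof -
  interpret ring "BW n" by (rule ring_BW)
  let ?P = "\<lambda>l. foldr (\<lambda>i p. u i \<otimes>\<^bsub>BW n\<^esub> p) l \<one>\<^bsub>BW n\<^esub>"
  have "?P l \<in> carrier (BW n) \<and> bw_op (?P l) v = foldr (\<lambda>i. bw_op (u i)) l v"
    if "set l \<subseteq> A" for l
    using that
  proof (induction l)
    case (Cons i l)
    then have "u i \<in> carrier (BW n)" using assms(2) by auto
    then show ?case using Cons by (simp add: bw_op_mult)
  qed simp
  then show ?thesis using assms(1) by (simp add: ordered_prod_def)
qed

lemma finite_subset_interval: "a \<subseteq> {1..n::nat} \<Longrightarrow> finite a"
  using finite_subset by blast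

lemma x_mon_closed: "a \<subseteq> {1..n} \<Longrightarrow> x_mon n a \<in> carrier (BW n)"
  and y_mon_closed: "a \<subseteq> {1..n} \<Longrightarrow> y_mon n a \<in> carrier (BW n)"
  unfolding x_mon_def y_mon_def
  by (intro monoid.ordered_prod_closed ring.is_monoid ring_BW bw_x_closed bw_y_closed
      finite_subset_interval; blast)+

text \<open>
  Multiplication operators by indicators compose to multiplication by the indicator of the conjunction;
  this serves the factors \<open>x\<^sub>i\<close> (membership) and \<open>x\<^sub>i + 1\<close> (non-membership) alike.
\<close>

lemma foldr_restrict:
  assumes "set l \<subseteq> A" "\<And>i v. i \<in> A \<Longrightarrow> op i v = (\<lambda>s. of_bool (P i s) * v s)"
  shows "foldr op l v s = of_bool (\<forall>i\<in>set l. P i s) * (v s :: bit)"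
  using assms(1) by (induction l) (auto simp: assms(2))

lemma bw_op_x_mon:
  assumes "a \<subseteq> {1..n}"
  shows "bw_op (x_mon n a) v s = of_bool (a \<subseteq> s) * v s"
proof -
  note fin = finite_subset_interval[OF assms]
  have "bw_op (x_mon n a) v s = foldr (\<lambda>i. bw_op (bw_x n i)) (sorted_list_of_set a) v s"
    unfolding x_mon_def by (subst bw_op_ordered_prod[OF fin]) (use assms bw_x_closed in blast)+
  also have "\<dots> = of_bool (\<forall>i\<in>a. i \<in> s) * v s"
    by (subst foldr_restrict[where P = "\<lambda>i s. i \<in> s" and A = a])
      (use assms fin in \<open>auto simp: bw_op_x subset_iff fun_eq_iff\<close>)
  finally show ?thesis by (simp add: subset_eq)
qed

lemma bw_op_y_mon:
  assumes "a \<subseteq> {1..n}"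
  shows "bw_op (y_mon n a) v s = bderiv a v s"
proof -
  note fin = finite_subset_interval[OF assms]
  have "foldr (\<lambda>i. bw_op (bw_y n i)) l v = bderiv (set l) v" if "set l \<subseteq> a" "distinct l" for l
    using that
  proof (induction l)
    case (Cons i l)
    then have "i \<in> {1..n}" using assms by auto
    then show ?case using Cons by (simp add: bw_op_y) (simp add: fun_eq_iff bderiv_bderiv)
  qed simp
  then show ?thesis
    unfolding y_mon_def using fin
    by (subst bw_op_ordered_prod[OF fin]) (use assms bw_y_closed in \<open>blast, simp\<close>)
qed

lemma m_mon_closed:
  assumes "a \<subseteq> {1..n}"
  shows "m_mon n a \<in> carrier (BW n)"
proof -
  interpret ring "BW n" by (rule ring_BW)
  show ?thesis
    unfolding m_mon_def x_mon_def[symmetric]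
    by (intro m_closed ordered_prod_closed x_mon_closed a_closed bw_x_closed assms) auto
qed

text \<open>
  The factors \<open>x\<^sub>i\<close> force \<open>a \<subseteq> s\<close>, and the factors \<open>x\<^sub>i + 1\<close> force \<open>s\<close> to avoid the complement of \<open>a\<close>. Only
  points inside \<open>{1..n}\<close> are pinned down completely by these conditions.
\<close>

lemma bw_op_m_mon:
  assumes "a \<subseteq> {1..n}" "s \<subseteq> {1..n}"
  shows "bw_op (m_mon n a) v s = of_bool (a = s) * v s"
proof -
  interpret ring "BW n" by (rule ring_BW)
  let ?u = "\<lambda>i. bw_x n i \<oplus>\<^bsub>BW n\<^esub> \<one>\<^bsub>BW n\<^esub>" and ?c = "{1..n} - a"
  have u: "?u i \<in> carrier (BW n)" if "i \<in> ?c" for i using that by (simp add: bw_x_closed)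
  have "bw_op (ordered_prod (BW n) ?u ?c) v s =
      foldr (\<lambda>i. bw_op (?u i)) (sorted_list_of_set ?c) v s"
    using u by (subst bw_op_ordered_prod) auto
  also have "\<dots> = of_bool (\<forall>i\<in>?c. i \<notin> s) * v s"
    by (subst foldr_restrict[where P = "\<lambda>i s. i \<notin> s" and A = ?c])
      (auto simp: bw_op_add bw_op_x bw_x_closed fun_eq_iff)
  finally have "bw_op (m_mon n a) v s = of_bool (a \<subseteq> s) * (of_bool (\<forall>i\<in>?c. i \<notin> s) * v s)"
    unfolding m_mon_def x_mon_def[symmetric]
    using assms(1) u by (subst bw_op_mult) (auto simp: x_mon_closed bw_op_x_mon intro!: ordered_prod_closed)
  moreover have "a = s \<longleftrightarrow> a \<subseteq> s \<and> (\<forall>i\<in>?c. i \<notin> s)" using assms by auto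
  ultimately show ?thesis by simp
qed

section \<open>Linear combinations of a family of monomials\<close>

lemma bw_scale_zero: "v \<in> carrier (BW n) \<Longrightarrow> bw_scale n 0 v = \<zero>\<^bsub>BW n\<^esub>"
  and bw_scale_one: "v \<in> carrier (BW n) \<Longrightarrow> bw_scale n 1 v = v"
proof -
  interpret ring "BW n" by (rule ring_BW)
  show "v \<in> carrier (BW n) \<Longrightarrow> bw_scale n 0 v = \<zero>\<^bsub>BW n\<^esub>"
    by (simp add: bw_scale_def bw_class_zero)
  show "v \<in> carrier (BW n) \<Longrightarrow> bw_scale n 1 v = v"
    by (simp add: bw_scale_def bw_class_one)
qed

lemma bw_scale_closed: "v \<in> carrier (BW n) \<Longrightarrow> bw_scale n k v \<in> carrier (BW n)"
  using ring.ring_simprules(2)[OF ring_BW]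
  by (cases k) (simp_all add: bw_scale_zero bw_scale_one)

lemma bw_scale_add:
  assumes "v \<in> carrier (BW n)"
  shows "bw_scale n (k + l) v = bw_scale n k v \<oplus>\<^bsub>BW n\<^esub> bw_scale n l v"
proof -
  interpret ring "BW n" by (rule ring_BW)
  show ?thesis using assms
    by (cases k; cases l) (simp_all add: bw_scale_zero bw_scale_one bw_add_self)
qed

lemma bw_op_scale: "w \<in> carrier (BW n) \<Longrightarrow> bw_op (bw_scale n k w) v s = k * bw_op w v s"
  by (cases k) (simp_all add: bw_scale_zero bw_scale_one)

text \<open>
  The sum that \<^const>\<open>bw_coord\<close> inverts, as a function of the coefficients.
\<close>

definition bw_comb ::
    "nat \<Rightarrow> (nat set \<Rightarrow> free_poly set) \<Rightarrow> (nat set \<Rightarrow> nat set \<Rightarrow> bit) \<Rightarrow> free_poly set"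
  where "bw_comb n B \<phi> = finsum (BW n) (\<lambda>(a, b). bw_scale n (\<phi> a b) (B a \<otimes>\<^bsub>BW n\<^esub> y_mon n b))
    (Pow {1..n} \<times> Pow {1..n})"

context
  fixes n :: nat and B :: "nat set \<Rightarrow> free_poly set"
  assumes B_closed: "\<And>a. a \<subseteq> {1..n} \<Longrightarrow> B a \<in> carrier (BW n)"
begin

interpretation ring "BW n" by (rule ring_BW)

lemma basis_closed:
  "a \<subseteq> {1..n} \<Longrightarrow> b \<subseteq> {1..n} \<Longrightarrow> B a \<otimes>\<^bsub>BW n\<^esub> y_mon n b \<in> carrier (BW n)"
  by (simp add: B_closed y_mon_closed)

lemma term_closed:
  "(\<lambda>(a, b). bw_scale n (\<phi> a b) (B a \<otimes>\<^bsub>BW n\<^esub> y_mon n b))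
    \<in> Pow {1..n} \<times> Pow {1..n} \<rightarrow> carrier (BW n)"
  by (intro funcsetI; clarify) (simp add: basis_closed bw_scale_closed)

lemma bw_comb_closed: "bw_comb n B \<phi> \<in> carrier (BW n)"
  unfolding bw_comb_def by (rule finsum_closed[OF term_closed])

lemma bw_comb_add: "bw_comb n B \<phi> \<oplus>\<^bsub>BW n\<^esub> bw_comb n B \<psi> = bw_comb n B (\<lambda>a b. \<phi> a b + \<psi> a b)"
  unfolding bw_comb_def finsum_addf[OF term_closed term_closed, symmetric]
proof (intro finsum_cong' refl term_closed; clarify)
  fix a b assume "a \<subseteq> {1..n}" "b \<subseteq> {1..n}"
  then show "bw_scale n (\<phi> a b) (B a \<otimes>\<^bsub>BW n\<^esub> y_mon n b)
        \<oplus>\<^bsub>BW n\<^esub> bw_scale n (\<psi> a b) (B a \<otimes>\<^bsub>BW n\<^esub> y_mon n b)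
      = bw_scale n (\<phi> a b + \<psi> a b) (B a \<otimes>\<^bsub>BW n\<^esub> y_mon n b)"
    by (simp only: bw_scale_add basis_closed)
qed

lemma bw_comb_zero: "bw_comb n B (\<lambda>a b. 0) = \<zero>\<^bsub>BW n\<^esub>"
proof -
  have "bw_comb n B (\<lambda>a b. 0) = finsum (BW n) (\<lambda>_. \<zero>\<^bsub>BW n\<^esub>) (Pow {1..n} \<times> Pow {1..n})"
    unfolding bw_comb_def by (rule finsum_cong'; clarify?) (simp_all add: basis_closed bw_scale_zero)
  then show ?thesis by simp
qed

lemma bw_comb_unit:
  assumes "a \<subseteq> {1..n}" "b \<subseteq> {1..n}"
  shows "bw_comb n B (\<lambda>a' b'. of_bool (a' = a \<and> b' = b)) = B a \<otimes>\<^bsub>BW n\<^esub> y_mon n b"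
proof -
  let ?t = "\<lambda>x. B (fst x) \<otimes>\<^bsub>BW n\<^esub> y_mon n (snd x)"
  have t: "?t \<in> Pow {1..n} \<times> Pow {1..n} \<rightarrow> carrier (BW n)"
    by (intro funcsetI; clarify) (simp add: basis_closed)
  have "bw_comb n B (\<lambda>a' b'. of_bool (a' = a \<and> b' = b)) =
      finsum (BW n) (\<lambda>x. if (a, b) = x then ?t x else \<zero>\<^bsub>BW n\<^esub>) (Pow {1..n} \<times> Pow {1..n})"
    unfolding bw_comb_def
  proof (rule finsum_cong')
    fix x assume "x \<in> Pow {1..n} \<times> Pow {1..n}"
    then obtain a' b' where x: "x = (a', b')" "a' \<subseteq> {1..n}" "b' \<subseteq> {1..n}" by blast
    show "(case x of (a', b') \<Rightarrow>
        bw_scale n (of_bool (a' = a \<and> b' = b)) (B a' \<otimes>\<^bsub>BW n\<^esub> y_mon n b')) =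
      (if (a, b) = x then ?t x else \<zero>\<^bsub>BW n\<^esub>)"
      using basis_closed[OF x(2,3)] unfolding x(1)
      by (cases "a' = a \<and> b' = b") (simp_all add: bw_scale_zero bw_scale_one)
  qed (use t in \<open>simp_all add: Pi_def\<close>)
  also have "\<dots> = ?t (a, b)"
    by (rule finsum_singleton[OF _ _ t]) (use assms in simp_all)
  finally show ?thesis by simp
qed

lemma bw_op_comb:
  "bw_op (bw_comb n B \<phi>) v s =
    (\<Sum>a\<in>Pow {1..n}. \<Sum>b\<in>Pow {1..n}. \<phi> a b * bw_op (B a) (bderiv b v) s)"
proof -
  have "bw_op (bw_comb n B \<phi>) v s =
      (\<Sum>(a, b)\<in>Pow {1..n} \<times> Pow {1..n}. \<phi> a b * bw_op (B a) (bderiv b v) s)"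
    unfolding bw_comb_def
  proof (subst bw_op_finsum)
    show "(\<Sum>x\<in>Pow {1..n} \<times> Pow {1..n}.
        bw_op (case x of (a, b) \<Rightarrow> bw_scale n (\<phi> a b) (B a \<otimes>\<^bsub>BW n\<^esub> y_mon n b)) v s) =
      (\<Sum>(a, b)\<in>Pow {1..n} \<times> Pow {1..n}. \<phi> a b * bw_op (B a) (bderiv b v) s)"
    proof (intro sum.cong refl; clarify)
      fix a b assume ab: "a \<subseteq> {1..n}" "b \<subseteq> {1..n}"
      have "bw_op (y_mon n b) v = bderiv b v"
        using bw_op_y_mon[OF ab(2)] by (simp add: fun_eq_iff)
      then show "bw_op (bw_scale n (\<phi> a b) (B a \<otimes>\<^bsub>BW n\<^esub> y_mon n b)) v s =
          \<phi> a b * bw_op (B a) (bderiv b v) s"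
        using ab by (simp add: bw_op_scale basis_closed bw_op_mult B_closed y_mon_closed)
    qed
  qed (simp, rule term_closed)
  then show ?thesis by (simp only: sum.cartesian_product)
qed

lemma zero_in_combs: "\<zero>\<^bsub>BW n\<^esub> \<in> range (bw_comb n B)"
  by (rule range_eqI) (rule bw_comb_zero[symmetric])

lemma finsum_in_combs:
  assumes "finite A" "\<And>x. x \<in> A \<Longrightarrow> F x \<in> range (bw_comb n B)"
  shows "finsum (BW n) F A \<in> range (bw_comb n B)"
  using assms
proof (induction A)
  case empty
  show ?case by (simp add: zero_in_combs)
next
  case (insert x A)
  obtain \<phi> where \<phi>: "F x = bw_comb n B \<phi>"
    using insert.prems[OF insertI1] by (rule rangeE)
  obtain \<psi> where \<psi>: "finsum (BW n) F A = bw_comb n B \<psi>"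
    using insert.IH[OF insert.prems[OF insertI2]] by (rule rangeE)
  have "F \<in> insert x A \<rightarrow> carrier (BW n)"
    by (intro funcsetI) (metis insert.prems rangeE bw_comb_closed)
  then have "finsum (BW n) F (insert x A) = F x \<oplus>\<^bsub>BW n\<^esub> finsum (BW n) F A"
    using insert.hyps by (intro finsum_insert) (simp_all add: Pi_def)
  then show ?case by (simp only: \<phi> \<psi> bw_comb_add rangeI)
qed

text \<open>
  Right multiplication is additive, so closure of the span under it can be tested on the family
  itself.
\<close>

lemma combs_mult_right:
  assumes u: "u \<in> carrier (BW n)"
    and basis: "\<And>a b. a \<subseteq> {1..n} \<Longrightarrow> b \<subseteq> {1..n} \<Longrightarrow>
      (B a \<otimes>\<^bsub>BW n\<^esub> y_mon n b) \<otimes>\<^bsub>BW n\<^esub> u \<in> range (bw_comb n B)"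
  shows "bw_comb n B \<phi> \<otimes>\<^bsub>BW n\<^esub> u \<in> range (bw_comb n B)"
proof -
  let ?F = "\<lambda>(a, b). bw_scale n (\<phi> a b) (B a \<otimes>\<^bsub>BW n\<^esub> y_mon n b)"
  have "bw_scale n k (B a \<otimes>\<^bsub>BW n\<^esub> y_mon n b) \<otimes>\<^bsub>BW n\<^esub> u \<in> range (bw_comb n B)"
    if "a \<subseteq> {1..n}" "b \<subseteq> {1..n}" for a b k
    using basis[OF that] basis_closed[OF that] u
    by (cases k) (simp_all add: bw_scale_zero bw_scale_one zero_in_combs)
  then have "finsum (BW n) (\<lambda>x. ?F x \<otimes>\<^bsub>BW n\<^esub> u) (Pow {1..n} \<times> Pow {1..n}) \<in> range (bw_comb n B)"
    by (intro finsum_in_combs; clarify?) simp_all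
  then show ?thesis
    unfolding bw_comb_def
    by (subst finsum_ldistr[OF _ u term_closed]) simp_all
qed

end

section \<open>The elements \<open>x\<^sup>a y\<^sup>b\<close> span\<close>

context
  fixes n :: nat
begin

interpretation ring "BW n" by (rule ring_BW)

lemma x_mon_mult_x:
  assumes a: "a \<subseteq> {1..n}" and i: "i \<in> {1..n}"
  shows "x_mon n a \<otimes>\<^bsub>BW n\<^esub> bw_x n i = x_mon n (insert i a)"
proof -
  have new: "x_mon n c \<otimes>\<^bsub>BW n\<^esub> bw_x n i = x_mon n (insert i c)"
    if c: "c \<subseteq> {1..n}" "i \<notin> c" for c
  proof -
    have comm: "bw_x n j \<otimes>\<^bsub>BW n\<^esub> bw_x n i = bw_x n i \<otimes>\<^bsub>BW n\<^esub> bw_x n j" if "j \<in> c" for j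
      using that c i by (intro bw_x_commute) blast+
    have closed: "bw_x n j \<in> carrier (BW n)" if "j \<in> insert i c" for j
      using that c i by (intro bw_x_closed) blast
    note fin = finite_subset_interval[OF c(1)]
    have "ordered_prod (BW n) (bw_x n) (insert i c) = bw_x n i \<otimes>\<^bsub>BW n\<^esub> ordered_prod (BW n) (bw_x n) c"
      by (rule ordered_prod_insert) (rule fin c(2) | erule closed comm)+
    moreover have "ordered_prod (BW n) (bw_x n) c \<otimes>\<^bsub>BW n\<^esub> bw_x n i = bw_x n i \<otimes>\<^bsub>BW n\<^esub> ordered_prod (BW n) (bw_x n) c"
      by (rule ordered_prod_commute) (rule fin closed[OF insertI1] | erule closed[OF insertI2] comm)+
    ultimately show ?thesis by (simp only: x_mon_def)
  qed
  show ?thesis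
  proof (cases "i \<in> a")
    case True
    then have a': "insert i a = a" "insert i (a - {i}) = a" "a - {i} \<subseteq> {1..n}" "i \<notin> a - {i}" 
      using a by blast+
    have "x_mon n a \<otimes>\<^bsub>BW n\<^esub> bw_x n i =
        x_mon n (a - {i}) \<otimes>\<^bsub>BW n\<^esub> (bw_x n i \<otimes>\<^bsub>BW n\<^esub> bw_x n i)"
      using new[OF a'(3,4)] x_mon_closed[OF a'(3)] bw_x_closed[OF i]
      unfolding a'(2) by (simp flip: m_assoc)
    then show ?thesis
      unfolding bw_x_idem[OF i i] new[OF a'(3,4)] a'(1,2) .
  qed (rule new[OF a])
qed

lemma y_mon_insert:
  assumes b: "b \<subseteq> {1..n}" and i: "i \<in> {1..n}" and new: "i \<notin> b"
  shows "y_mon n (insert i b) = y_mon n b \<otimes>\<^bsub>BW n\<^esub> bw_y n i"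
proof -
  have comm: "bw_y n j \<otimes>\<^bsub>BW n\<^esub> bw_y n i = bw_y n i \<otimes>\<^bsub>BW n\<^esub> bw_y n j" if "j \<in> b" for j
    using that b i by (intro bw_y_commute) blast+
  have closed: "bw_y n j \<in> carrier (BW n)" if "j \<in> insert i b" for j
    using that b i by (intro bw_y_closed) blast
  note fin = finite_subset_interval[OF b]
  have "ordered_prod (BW n) (bw_y n) (insert i b) = bw_y n i \<otimes>\<^bsub>BW n\<^esub> ordered_prod (BW n) (bw_y n) b"
      by (rule ordered_prod_insert) (rule fin new | erule closed comm)+
    moreover have "ordered_prod (BW n) (bw_y n) b \<otimes>\<^bsub>BW n\<^esub> bw_y n i = bw_y n i \<otimes>\<^bsub>BW n\<^esub> ordered_prod (BW n) (bw_y n) b"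
      by (rule ordered_prod_commute) (rule fin closed[OF insertI1] | erule closed[OF insertI2] comm)+
    ultimately show ?thesis by (simp only: y_mon_def)
qed

lemma y_mon_remove:
  assumes "b \<subseteq> {1..n}" "i \<in> b"
  shows "y_mon n b = y_mon n (b - {i}) \<otimes>\<^bsub>BW n\<^esub> bw_y n i"
proof -
  have b: "insert i (b - {i}) = b" "b - {i} \<subseteq> {1..n}" "i \<in> {1..n}" "i \<notin> b - {i}"
    using assms by blast+
  show ?thesis using y_mon_insert[OF b(2-4)] unfolding b(1) .
qed

lemma y_mon_mult_y:
  assumes b: "b \<subseteq> {1..n}" and i: "i \<in> b"
  shows "y_mon n b \<otimes>\<^bsub>BW n\<^esub> bw_y n i = \<zero>\<^bsub>BW n\<^esub>"
proof -
  have i': "i \<in> {1..n}" and b': "b - {i} \<subseteq> {1..n}" using assms by blast+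
  show ?thesis
    unfolding y_mon_remove[OF assms]
    using bw_y_square[OF i' i'] y_mon_closed[OF b'] bw_y_closed[OF i'] by (simp add: m_assoc)
qed

lemma y_mon_mult_x_commute:
  assumes b: "b \<subseteq> {1..n}" and i: "i \<in> {1..n}" and "i \<notin> b"
  shows "y_mon n b \<otimes>\<^bsub>BW n\<^esub> bw_x n i = bw_x n i \<otimes>\<^bsub>BW n\<^esub> y_mon n b"
  unfolding y_mon_def
proof (rule ordered_prod_commute)
  show "bw_y n j \<otimes>\<^bsub>BW n\<^esub> bw_x n i = bw_x n i \<otimes>\<^bsub>BW n\<^esub> bw_y n j" if "j \<in> b" for j
    using that assms by (intro bw_y_x_commute) blast+
  show "bw_y n j \<in> carrier (BW n)" if "j \<in> b" for j
    using that b by (intro bw_y_closed) blast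
qed (rule finite_subset_interval[OF b] bw_x_closed[OF i])+

text \<open>
  The factors of \<open>y\<^sup>b\<close> commute, so \<open>y\<^sub>i\<close> may be put last; the relation for \<open>y\<^sub>i x\<^sub>i\<close> then applies, and what
  remains of \<open>y\<^sup>b\<close> commutes with \<open>x\<^sub>i\<close>.
\<close>

lemma y_mon_mult_x_same:
  assumes b: "b \<subseteq> {1..n}" and i: "i \<in> b"
  shows "y_mon n b \<otimes>\<^bsub>BW n\<^esub> bw_x n i =
    bw_x n i \<otimes>\<^bsub>BW n\<^esub> y_mon n b \<oplus>\<^bsub>BW n\<^esub> (y_mon n b \<oplus>\<^bsub>BW n\<^esub> y_mon n (b - {i}))"
proof -
  have i': "i \<in> {1..n}" and b': "b - {i} \<subseteq> {1..n}" "i \<notin> b - {i}" using assms by blast+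
  note closed = bw_x_closed[OF i'] bw_y_closed[OF i'] y_mon_closed[OF b'(1)]
  let ?x = "bw_x n i" and ?y = "bw_y n i" and ?Y = "y_mon n (b - {i})"
  have "y_mon n b \<otimes>\<^bsub>BW n\<^esub> ?x = ?Y \<otimes>\<^bsub>BW n\<^esub> (?y \<otimes>\<^bsub>BW n\<^esub> ?x)"
    unfolding y_mon_remove[OF assms] using closed by (simp add: m_assoc)
  also have "\<dots> = (?Y \<otimes>\<^bsub>BW n\<^esub> ?x) \<otimes>\<^bsub>BW n\<^esub> ?y \<oplus>\<^bsub>BW n\<^esub> (?Y \<otimes>\<^bsub>BW n\<^esub> ?y \<oplus>\<^bsub>BW n\<^esub> ?Y)"
    unfolding bw_y_x_same[OF i' i'] using closed by (simp add: r_distr m_assoc)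
  also have "\<dots> = ?x \<otimes>\<^bsub>BW n\<^esub> y_mon n b \<oplus>\<^bsub>BW n\<^esub> (y_mon n b \<oplus>\<^bsub>BW n\<^esub> ?Y)"
    unfolding y_mon_mult_x_commute[OF b'(1) i' b'(2)] y_mon_remove[OF assms]
    using closed by (simp add: m_assoc)
  finally show ?thesis .
qed

abbreviation "x_span \<equiv> range (bw_comb n (x_mon n))"

lemma x_span_add: "f \<in> x_span \<Longrightarrow> g \<in> x_span \<Longrightarrow> f \<oplus>\<^bsub>BW n\<^esub> g \<in> x_span"
  by (elim rangeE) (simp only: bw_comb_add x_mon_closed rangeI)

lemma basis_in_x_span:
  assumes "a \<subseteq> {1..n}" "b \<subseteq> {1..n}"
  shows "x_mon n a \<otimes>\<^bsub>BW n\<^esub> y_mon n b \<in> x_span"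
  by (rule range_eqI) (rule bw_comb_unit[OF x_mon_closed assms, symmetric])

lemma x_span_mult_y:
  assumes "f \<in> x_span" and i: "i \<in> {1..n}"
  shows "f \<otimes>\<^bsub>BW n\<^esub> bw_y n i \<in> x_span"
proof -
  have "(x_mon n a \<otimes>\<^bsub>BW n\<^esub> y_mon n b) \<otimes>\<^bsub>BW n\<^esub> bw_y n i \<in> x_span"
    if ab: "a \<subseteq> {1..n}" "b \<subseteq> {1..n}" for a b
  proof -
    have "(x_mon n a \<otimes>\<^bsub>BW n\<^esub> y_mon n b) \<otimes>\<^bsub>BW n\<^esub> bw_y n i
        = x_mon n a \<otimes>\<^bsub>BW n\<^esub> (y_mon n b \<otimes>\<^bsub>BW n\<^esub> bw_y n i)"
      by (rule m_assoc[OF x_mon_closed[OF ab(1)] y_mon_closed[OF ab(2)] bw_y_closed[OF i]])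
    also have "\<dots> \<in> x_span"
    proof (cases "i \<in> b")
      case True
      show ?thesis
        unfolding y_mon_mult_y[OF ab(2) True] r_null[OF x_mon_closed[OF ab(1)]]
        by (rule zero_in_combs[OF x_mon_closed])
    next
      case False
      have "insert i b \<subseteq> {1..n}" using ab i by blast
      then show ?thesis
        unfolding y_mon_insert[OF ab(2) i False, symmetric] by (rule basis_in_x_span[OF ab(1)])
    qed
    finally show ?thesis .
  qed
  with assms(1) show ?thesis
    by (elim rangeE) (simp only: combs_mult_right[OF x_mon_closed bw_y_closed[OF i]])
qed

text \<open>
  Multiplying from the right moves \<open>x\<^sub>i\<close> only past \<open>y\<^sup>b\<close>, where the rule is explicit; the result is absorbed
  in \<open>x\<^sup>a\<close> because \<open>x\<^sub>i\<close> is idempotent.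
\<close>

lemma x_span_mult_x:
  assumes "f \<in> x_span" and i: "i \<in> {1..n}"
  shows "f \<otimes>\<^bsub>BW n\<^esub> bw_x n i \<in> x_span"
proof -
  have "(x_mon n a \<otimes>\<^bsub>BW n\<^esub> y_mon n b) \<otimes>\<^bsub>BW n\<^esub> bw_x n i \<in> x_span"
    if ab: "a \<subseteq> {1..n}" "b \<subseteq> {1..n}" for a b
  proof -
    have b': "b - {i} \<subseteq> {1..n}" and ia: "insert i a \<subseteq> {1..n}" using ab i by blast+
    note closed = x_mon_closed[OF ab(1)] y_mon_closed[OF ab(2)] bw_x_closed[OF i] y_mon_closed[OF b']
    have swapped: "x_mon n a \<otimes>\<^bsub>BW n\<^esub> (bw_x n i \<otimes>\<^bsub>BW n\<^esub> y_mon n b)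
        = x_mon n (insert i a) \<otimes>\<^bsub>BW n\<^esub> y_mon n b"
      unfolding x_mon_mult_x[OF ab(1) i, symmetric] using closed by (simp add: m_assoc)
    show ?thesis
    proof (cases "i \<in> b")
      case True
      have "(x_mon n a \<otimes>\<^bsub>BW n\<^esub> y_mon n b) \<otimes>\<^bsub>BW n\<^esub> bw_x n i =
          x_mon n (insert i a) \<otimes>\<^bsub>BW n\<^esub> y_mon n b \<oplus>\<^bsub>BW n\<^esub>
            (x_mon n a \<otimes>\<^bsub>BW n\<^esub> y_mon n b \<oplus>\<^bsub>BW n\<^esub> x_mon n a \<otimes>\<^bsub>BW n\<^esub> y_mon n (b - {i}))"
        unfolding swapped[symmetric]
        using y_mon_mult_x_same[OF ab(2) True] closed by (simp add: m_assoc r_distr)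
      then show ?thesis
        using x_span_add basis_in_x_span ab b' ia by simp
    next
      case False
      have "(x_mon n a \<otimes>\<^bsub>BW n\<^esub> y_mon n b) \<otimes>\<^bsub>BW n\<^esub> bw_x n i =
          x_mon n (insert i a) \<otimes>\<^bsub>BW n\<^esub> y_mon n b"
        unfolding swapped[symmetric]
        using y_mon_mult_x_commute[OF ab(2) i False] closed by (simp add: m_assoc)
      then show ?thesis using basis_in_x_span[OF ia ab(2)] by simp
    qed
  qed
  with assms(1) show ?thesis
    by (elim rangeE) (simp only: combs_mult_right[OF x_mon_closed bw_x_closed[OF i]])
qed

text \<open>
  Words are read from left to right, each letter acting by right multiplication on the span. As the
  only scalars are \<open>0\<close> and \<open>1\<close>, every polynomial is a sum of words.
\<close>

lemma word_in_x_span: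
  assumes "set l \<subseteq> gens n"
  shows "Poly_Mapping.single (Word l) 1 \<in> carrier (free_alg n) \<and>
    bw_class n (Poly_Mapping.single (Word l) 1) \<in> x_span"
  using assms
proof (induction l rule: rev_induct)
  case Nil
  have "x_mon n {} \<otimes>\<^bsub>BW n\<^esub> y_mon n {} = \<one>\<^bsub>BW n\<^esub>" by (simp add: x_mon_def y_mon_def)
  then have "\<one>\<^bsub>BW n\<^esub> \<in> x_span" using basis_in_x_span[of "{}" "{}"] by simp
  moreover have "Poly_Mapping.single (Word []) 1 = (1 :: free_poly)"
    by (simp flip: zero_free_word_def)
  ultimately show ?case by (simp add: bw_class_one)
next
  case (snoc u l)
  have eq: "Poly_Mapping.single (Word (l @ [u])) 1 = Poly_Mapping.single (Word l) 1 * var u"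
    by (simp add: var_def mult_single plus_free_word_def)
  have u: "u \<in> gens n" and l: "set l \<subseteq> gens n" using snoc.prems by simp_all
  have "bw_class n (Poly_Mapping.single (Word l) 1) \<otimes>\<^bsub>BW n\<^esub> bw_class n (var u) \<in> x_span"
  proof (cases u)
    case (GenX i)
    then have i: "i \<in> {1..n}" using u by (auto simp: gens_def)
    show ?thesis
      unfolding GenX bw_x_def[symmetric] using snoc.IH[OF l] i by (blast intro: x_span_mult_x)
  next
    case (GenY i)
    then have i: "i \<in> {1..n}" using u by (auto simp: gens_def)
    show ?thesis
      unfolding GenY bw_y_def[symmetric] using snoc.IH[OF l] i by (blast intro: x_span_mult_y)
  qed
  then show ?case
    using snoc.IH[OF l] free_alg_var[OF u] unfolding eq
    by (simp add: bw_class_mult free_alg_closed)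
qed

lemma x_monomials_span:
  assumes "f \<in> carrier (BW n)"
  shows "f \<in> x_span"
proof -
  obtain p where p: "p \<in> carrier (free_alg n)" "f = bw_class n p"
    using assms by (rule BW_cases)
  let ?t = "\<lambda>w. Poly_Mapping.single w (Poly_Mapping.lookup p w)"
  have "(\<Sum>w\<in>W. ?t w) \<in> carrier (free_alg n) \<and> bw_class n (\<Sum>w\<in>W. ?t w) \<in> x_span"
    if "finite W" "W \<subseteq> Poly_Mapping.keys p" for W
    using that
  proof (induction W)
    case empty
    show ?case using zero_in_combs[OF x_mon_closed] by (simp add: bw_class_zero)
  next
    case (insert w W)
    have "?t w = Poly_Mapping.single (Word (letters w)) 1" "set (letters w) \<subseteq> gens n"
      using insert.prems p(1) by (auto simp: carrier_free_alg in_keys_iff)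
    then have "?t w \<in> carrier (free_alg n) \<and> bw_class n (?t w) \<in> x_span"
      using word_in_x_span[of "letters w"] by simp
    then show ?case
      using insert x_span_add by (simp add: free_alg_closed flip: bw_class_add)
  qed
  from this[of "Poly_Mapping.keys p"] show ?thesis by (simp add: p(2) sum_monomials)
qed

end

section \<open>Coordinates read off from the operator\<close>

text \<open>
  The value at \<open>s\<close> of the operator applied to \<open>r \<mapsto> [b \<subseteq> r + s]\<close>. This test function is dual to
  the derivatives at \<open>s\<close> (\<open>bderiv_test_function\<close>), as a monomial centred at a point is dual to the
  derivatives there.
\<close>

definition m_coeff :: "free_poly set \<Rightarrow> nat set \<Rightarrow> nat set \<Rightarrow> bit"
  where "m_coeff f s b = bw_op f (\<lambda>r. of_bool (b \<subseteq> sym_diff r s)) s"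

text \<open>
  The operator of \<open>x\<^sup>a y\<^sup>b\<close> contributes to the coefficient of \<open>\<partial>\<^sup>b\<close> at every \<open>s\<close> containing \<open>a\<close>, so the
  coefficients at \<open>s\<close> are subset sums of the \<open>x\<close>-coordinates. The sum over subsets undoes this.
\<close>

definition x_coeff :: "free_poly set \<Rightarrow> nat set \<Rightarrow> nat set \<Rightarrow> bit"
  where "x_coeff f a b = (\<Sum>s\<in>Pow a. m_coeff f s b)"

lemma bderiv_test_function:
  assumes "finite b"
  shows "bderiv b (\<lambda>r. of_bool (c \<subseteq> sym_diff r s)) s = of_bool (b = c)"
proof -
  have "sym_diff (sym_diff s t) s = t" for t by auto
  then have "bderiv b (\<lambda>r. of_bool (c \<subseteq> sym_diff r s)) s = (\<Sum>t\<in>Pow b. of_bool (c \<subseteq> t))"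
    by (simp add: bderiv_def)
  also have "\<dots> = (\<Sum>t | c \<subseteq> t \<and> t \<subseteq> b. 1)"
    using assms by (intro sum.mono_neutral_cong_right) auto
  also have "\<dots> = of_bool (b = c)"
  proof (cases "c \<subseteq> b")
    case True
    show ?thesis unfolding sum_one_interval[OF assms True] by auto
  next
    case False
    then have none: "{t. c \<subseteq> t \<and> t \<subseteq> b} = {}" by auto
    show ?thesis unfolding none using False by auto
  qed
  finally show ?thesis .
qed

lemma m_coeff_unique:
  assumes "\<And>v. bw_op f v s = (\<Sum>b\<in>Pow {1..n}. \<Phi> b * bderiv b v s)" and c: "c \<subseteq> {1..n}"
  shows "m_coeff f s c = \<Phi> c"
proof -
  have "m_coeff f s c = (\<Sum>b\<in>Pow {1..n}. \<Phi> b * of_bool (b = c))"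
    unfolding m_coeff_def assms(1)
    by (intro sum.cong refl) (simp only: Pow_iff bderiv_test_function[OF finite_subset_interval])
  then show ?thesis using c by (simp add: sum.delta of_bool_def if_distrib[of "\<lambda>x. _ * x"] cong: if_cong)
qed

lemma x_coeff_unique:
  assumes op: "\<And>v s. s \<subseteq> {1..n} \<Longrightarrow> bw_op f v s =
      (\<Sum>a\<in>Pow {1..n}. \<Sum>b\<in>Pow {1..n}. \<Phi> a b * (of_bool (a \<subseteq> s) * bderiv b v s))"
    and a: "a \<subseteq> {1..n}" and c: "c \<subseteq> {1..n}"
  shows "x_coeff f a c = \<Phi> a c"
proof -
  have "m_coeff f s c = (\<Sum>a\<in>Pow s. \<Phi> a c)" if s: "s \<subseteq> {1..n}" for s
  proof (rule m_coeff_unique[OF _ c])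
    fix v
    have "bw_op f v s = (\<Sum>b\<in>Pow {1..n}. (\<Sum>a\<in>Pow {1..n}. \<Phi> a b * of_bool (a \<subseteq> s)) * bderiv b v s)"
      unfolding op[OF s] by (subst sum.swap) (simp only: sum_distrib_right mult.assoc)
    moreover have "(\<Sum>a\<in>Pow {1..n}. \<Phi> a b * of_bool (a \<subseteq> s)) = (\<Sum>a\<in>Pow s. \<Phi> a b)" for b
      using s by (intro sum.mono_neutral_cong_right) auto
    ultimately show "bw_op f v s = (\<Sum>b\<in>Pow {1..n}. (\<Sum>a\<in>Pow s. \<Phi> a b) * bderiv b v s)"
      by (simp only:)
  qed
  then have "x_coeff f a c = (\<Sum>s\<in>Pow a. \<Sum>a\<in>Pow s. \<Phi> a c)"
    unfolding x_coeff_def using a by (intro sum.cong) auto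
  also have "\<dots> = \<Phi> a c"
    by (rule moebius_inversion[OF finite_subset_interval[OF a]])
  finally show ?thesis .
qed

lemma bw_op_x_comb:
  "bw_op (bw_comb n (x_mon n) \<phi>) v s =
    (\<Sum>a\<in>Pow {1..n}. \<Sum>b\<in>Pow {1..n}. \<phi> a b * (of_bool (a \<subseteq> s) * bderiv b v s))"
  by (subst bw_op_comb, erule x_mon_closed)
    (intro sum.cong refl; simp only: Pow_iff bw_op_x_mon)

lemma bw_op_m_comb:
  assumes s: "s \<subseteq> {1..n}"
  shows "bw_op (bw_comb n (m_mon n) \<phi>) v s = (\<Sum>b\<in>Pow {1..n}. \<phi> s b * bderiv b v s)"
proof -
  have "bw_op (bw_comb n (m_mon n) \<phi>) v s =
      (\<Sum>a\<in>Pow {1..n}. of_bool (a = s) * (\<Sum>b\<in>Pow {1..n}. \<phi> a b * bderiv b v s))"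
    unfolding sum_distrib_left
    by (subst bw_op_comb, erule m_mon_closed)
      (intro sum.cong refl; simp only: Pow_iff bw_op_m_mon[OF _ s] mult.left_commute)
  then show ?thesis
    using s by (simp add: sum.delta of_bool_def if_distrib[of "\<lambda>x. x * _"] cong: if_cong)
qed

lemma bw_comb_cong:
  assumes "\<And>a. a \<subseteq> {1..n} \<Longrightarrow> B a \<in> carrier (BW n)"
    and eq: "\<And>a b. a \<subseteq> {1..n} \<Longrightarrow> b \<subseteq> {1..n} \<Longrightarrow> \<phi> a b = \<psi> a b"
  shows "bw_comb n B \<phi> = bw_comb n B \<psi>"
proof -
  interpret ring "BW n" by (rule ring_BW)
  show ?thesis
    unfolding bw_comb_def
    by (rule finsum_cong'[OF refl term_closed[OF assms(1)]]) (auto simp only: eq Pow_iff mem_Times_iff split_beta)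
qed

lemma bw_eq_x_comb:
  assumes "f \<in> carrier (BW n)"
  shows "f = bw_comb n (x_mon n) (x_coeff f)"
proof -
  obtain \<phi> where \<phi>: "f = bw_comb n (x_mon n) \<phi>"
    using x_monomials_span[OF assms] by (rule rangeE)
  have "x_coeff f a b = \<phi> a b" if "a \<subseteq> {1..n}" "b \<subseteq> {1..n}" for a b
    using that by (intro x_coeff_unique) (simp_all only: \<phi> bw_op_x_comb)
  then have "bw_comb n (x_mon n) (x_coeff f) = bw_comb n (x_mon n) \<phi>"
    by (intro bw_comb_cong x_mon_closed) simp_all
  then show ?thesis using \<phi> by simp
qed

text \<open>
  The operator determines the \<open>x\<close>-coordinates, and these determine the element because the \<open>x\<^sup>a y\<^sup>b\<close>
  span. Points inside \<open>{1..n}\<close> suffice, since the coordinates are read off there.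
\<close>

lemma bw_op_faithful:
  assumes "f \<in> carrier (BW n)" "g \<in> carrier (BW n)"
    and eq: "\<And>v s. s \<subseteq> {1..n} \<Longrightarrow> bw_op f v s = bw_op g v s"
  shows "f = g"
proof -
  have "m_coeff f s b = m_coeff g s b" if "s \<subseteq> {1..n}" for s b
    using eq[OF that] by (simp add: m_coeff_def)
  then have "x_coeff f a b = x_coeff g a b" if "a \<subseteq> {1..n}" for a b
    using that unfolding x_coeff_def by (intro sum.cong refl) (auto simp: subset_iff)
  then have "bw_comb n (x_mon n) (x_coeff f) = bw_comb n (x_mon n) (x_coeff g)"
    by (intro bw_comb_cong x_mon_closed) simp_all
  then show ?thesis using assms(1,2)[THEN bw_eq_x_comb] by simp
qed

text \<open>
  Collecting the \<open>x\<close>-expansion by derivatives shows that at each point the operator is a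
  combination of the \<open>\<partial>\<^sup>b\<close>; the test functions identify its coefficients.
\<close>

lemma bw_op_m_coeff:
  assumes "f \<in> carrier (BW n)" and s: "s \<subseteq> {1..n}"
  shows "bw_op f v s = (\<Sum>b\<in>Pow {1..n}. m_coeff f s b * bderiv b v s)"
proof -
  have op: "bw_op f v s = (\<Sum>b\<in>Pow {1..n}. (\<Sum>a\<in>Pow {1..n}. x_coeff f a b * of_bool (a \<subseteq> s)) * bderiv b v s)"
    for v
    by (subst bw_eq_x_comb[OF assms(1)], unfold bw_op_x_comb, subst sum.swap)
      (simp only: sum_distrib_right mult.assoc)
  have "m_coeff f s b = (\<Sum>a\<in>Pow {1..n}. x_coeff f a b * of_bool (a \<subseteq> s))" if "b \<subseteq> {1..n}" for b
    by (rule m_coeff_unique[OF op that])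
  then show ?thesis unfolding op by (intro sum.cong refl) simp
qed

text \<open>
  Faithfulness yields the expansion directly: the combination with these coefficients has the operator
  of \<open>f\<close>.
\<close>

lemma bw_eq_m_comb:
  assumes "f \<in> carrier (BW n)"
  shows "f = bw_comb n (m_mon n) (m_coeff f)"
proof (rule bw_op_faithful[OF assms])
  show "bw_comb n (m_mon n) (m_coeff f) \<in> carrier (BW n)"
    by (rule bw_comb_closed) (rule m_mon_closed)
  show "bw_op f v s = bw_op (bw_comb n (m_mon n) (m_coeff f)) v s" if "s \<subseteq> {1..n}" for v s
    unfolding bw_op_m_comb[OF that] by (rule bw_op_m_coeff[OF assms that])
qed

text \<open>
  The definite description in \<^const>\<open>bw_coord\<close> requires uniqueness as a function, so the coefficients
  are first cut off to zero outside the index range.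
\<close>

lemma bw_coord_eq:
  assumes closed: "\<And>a. a \<subseteq> {1..n} \<Longrightarrow> B a \<in> carrier (BW n)"
    and expansion: "f = bw_comb n B \<phi>"
    and unique: "\<And>\<psi> a b. f = bw_comb n B \<psi> \<Longrightarrow> a \<subseteq> {1..n} \<Longrightarrow> b \<subseteq> {1..n} \<Longrightarrow> \<psi> a b = \<phi> a b"
    and ab: "a \<subseteq> {1..n}" "b \<subseteq> {1..n}"
  shows "bw_coord n B f a b = \<phi> a b"
proof -
  define \<phi>' where "\<phi>' a b = (if a \<subseteq> {1..n} \<and> b \<subseteq> {1..n} then \<phi> a b else 0)" for a b
  have "bw_coord n B f = \<phi>'"
    unfolding bw_coord_def bw_comb_def[symmetric]
  proof (rule the_equality)
    have "f = bw_comb n B \<phi>'"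
      unfolding expansion by (rule bw_comb_cong[OF closed]) (simp_all add: \<phi>'_def)
    then show "(\<forall>a b. \<not> (a \<subseteq> {1..n} \<and> b \<subseteq> {1..n}) \<longrightarrow> \<phi>' a b = 0) \<and> f = bw_comb n B \<phi>'"
      by (simp add: \<phi>'_def)
  next
    fix \<psi> assume "(\<forall>a b. \<not> (a \<subseteq> {1..n} \<and> b \<subseteq> {1..n}) \<longrightarrow> \<psi> a b = 0) \<and> f = bw_comb n B \<psi>"
    then show "\<psi> = \<phi>'" using unique[of \<psi>] unfolding \<phi>'_def fun_eq_iff by metis
  qed
  then show ?thesis using ab by (simp add: \<phi>'_def)
qed

lemma m_coord_eq_m_coeff:
  assumes "f \<in> carrier (BW n)" "a \<subseteq> {1..n}" "b \<subseteq> {1..n}"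
  shows "m_coord n f a b = m_coeff f a b"
  unfolding m_coord_def using m_mon_closed bw_eq_m_comb[OF assms(1)] _ assms(2,3)
proof (rule bw_coord_eq)
  show "\<psi> a b = m_coeff f a b" if "f = bw_comb n (m_mon n) \<psi>" "a \<subseteq> {1..n}" "b \<subseteq> {1..n}" for \<psi> a b
    unfolding that(1) by (rule m_coeff_unique[OF bw_op_m_comb, symmetric]) (fact that)+
qed

lemma x_coord_eq_x_coeff:
  assumes "f \<in> carrier (BW n)" "a \<subseteq> {1..n}" "b \<subseteq> {1..n}"
  shows "x_coord n f a b = x_coeff f a b"
  unfolding x_coord_def using x_mon_closed bw_eq_x_comb[OF assms(1)] _ assms(2,3)
proof (rule bw_coord_eq)
  show "\<psi> a b = x_coeff f a b" if "f = bw_comb n (x_mon n) \<psi>" "a \<subseteq> {1..n}" "b \<subseteq> {1..n}" for \<psi> a b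
    unfolding that(1) by (rule x_coeff_unique[OF bw_op_x_comb, symmetric]) (fact that)+
qed

section \<open>The product formulas\<close>

lemma sum_of_bool_eq_point:
  assumes "finite A" "\<And>x. x \<in> A \<Longrightarrow> P x \<longleftrightarrow> Q \<and> x = y" "Q \<Longrightarrow> y \<in> A"
  shows "(\<Sum>x\<in>A. of_bool (P x) * F x) = of_bool Q * (F y :: bit)"
proof -
  have "(\<Sum>x\<in>A. of_bool (P x) * F x) = (\<Sum>x\<in>A. if x = y then of_bool Q * F y else 0)"
    using assms(2) by (intro sum.cong) auto
  also have "\<dots> = of_bool Q * F y" using assms(1,3) by auto
  finally show ?thesis .
qed

text \<open>
  Taylor's formula for a derivative: \<open>\<partial>\<^sup>u \<partial>\<^sup>d\<close> survives only for \<open>u\<close> disjoint from \<open>d\<close>, and \<open>e = u \<union> d\<close>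
  recovers \<open>u\<close> as \<open>e - d\<close>.
\<close>

lemma bderiv_translate:
  assumes t: "t \<subseteq> {1..n::nat}" and d: "d \<subseteq> {1..n}"
  shows "bderiv d v (sym_diff s t) =
    (\<Sum>e\<in>Pow {1..n}. of_bool (d \<subseteq> e \<and> e - d \<subseteq> t) * bderiv e v s)"
proof -
  have fin: "finite u" if "u \<in> Pow t" for u
    by (rule finite_subset[OF _ finite_subset_interval[OF t]]) (use that in simp)
  have "bderiv d v (sym_diff s t) = (\<Sum>u\<in>Pow t. of_bool (u \<inter> d = {}) * bderiv (u \<union> d) v s)"
    unfolding translate_eq_sum_bderiv[OF finite_subset_interval[OF t]]
    by (intro sum.cong refl) (simp only: bderiv_bderiv fin finite_subset_interval[OF d])
  also have "\<dots> = (\<Sum>u | u \<in> Pow t \<and> u \<inter> d = {}. bderiv (u \<union> d) v s)"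
    using finite_subset_interval[OF t] by (intro sum.mono_neutral_cong_right) auto
  also have "\<dots> = (\<Sum>e | e \<in> Pow {1..n} \<and> d \<subseteq> e \<and> e - d \<subseteq> t. bderiv e v s)"
    by (rule sum.reindex_bij_witness[of _ "\<lambda>e. e - d" "\<lambda>u. u \<union> d"])
      (use t d in \<open>auto simp: Un_absorb2\<close>)
  also have "\<dots> = (\<Sum>e\<in>Pow {1..n}. of_bool (d \<subseteq> e \<and> e - d \<subseteq> t) * bderiv e v s)"
    by (intro sum.mono_neutral_cong_left) auto
  finally show ?thesis .
qed

lemma sum_swap_triple:
  "(\<Sum>b\<in>B. \<Sum>c\<in>C. \<Sum>d\<in>D. \<Sum>e\<in>E. F b c d e) = (\<Sum>e\<in>E. \<Sum>b\<in>B. \<Sum>c\<in>C. \<Sum>d\<in>D. F b c d e)"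
  by (simp only: sum.swap[where A = D and B = E] sum.swap[where A = C and B = E]
      sum.swap[where A = B and B = E])

lemma sum_swap_quadruple:
  "(\<Sum>a\<in>A. \<Sum>b\<in>B. \<Sum>c\<in>C. \<Sum>d\<in>D. \<Sum>e\<in>E. \<Sum>h\<in>H. F a b c d e h) =
    (\<Sum>e\<in>E. \<Sum>h\<in>H. \<Sum>a\<in>A. \<Sum>b\<in>B. \<Sum>c\<in>C. \<Sum>d\<in>D. F a b c d e h)"
  by (simp only: sum.swap[where A = D and B = E] sum.swap[where A = C and B = E]
      sum.swap[where A = B and B = E] sum.swap[where A = A and B = E]
      sum.swap[where A = D and B = H] sum.swap[where A = C and B = H]
      sum.swap[where A = B and B = H] sum.swap[where A = A and B = H])

text \<open>
  The operator of the product at \<open>a\<close> is \<open>\<Sum>b. f\<^sub>m(a,b) * \<partial>\<^sup>b\<close> applied to the function produced by \<open>g\<close>. As a sum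
  of translations, \<open>\<partial>\<^sup>b\<close> visits the points \<open>c\<close> with \<open>a + c \<subseteq> b\<close>, where the operator of \<open>g\<close> is
  \<open>\<Sum>d. g\<^sub>m(c,d) * \<partial>\<^sup>d\<close>; \<open>bderiv_translate\<close> brings the derivatives back from \<open>c\<close> to \<open>a\<close>.
\<close>

lemma m_coeff_mult:
  assumes f: "f \<in> carrier (BW n)" and g: "g \<in> carrier (BW n)"
    and a: "a \<subseteq> {1..n}" and e: "e \<subseteq> {1..n}"
  shows "m_coeff (f \<otimes>\<^bsub>BW n\<^esub> g) a e =
    (\<Sum>b\<in>Pow {1..n}. \<Sum>c\<in>Pow {1..n}. \<Sum>d\<in>Pow {1..n}.
      of_bool (d \<subseteq> e \<and> e - d \<subseteq> sym_diff a c \<and> sym_diff a c \<subseteq> b) * (m_coeff f a b * m_coeff g c d))"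
proof (rule m_coeff_unique[OF _ e])
  fix v
  let ?N = "Pow {1..n}"
  let ?D = "\<lambda>e. bderiv e v a"
  have bderiv_op_g: "bderiv b (bw_op g v) a = (\<Sum>c\<in>?N. \<Sum>d\<in>?N. \<Sum>e\<in>?N.
      of_bool (d \<subseteq> e \<and> e - d \<subseteq> sym_diff a c \<and> sym_diff a c \<subseteq> b) * m_coeff g c d * ?D e)"
    if b: "b \<in> ?N" for b
  proof -
    have "bderiv b (bw_op g v) a = (\<Sum>c | c \<in> ?N \<and> sym_diff a c \<subseteq> b. bw_op g v c)"
      unfolding bderiv_def
      by (rule sum.reindex_bij_witness[of _ "\<lambda>c. sym_diff a c" "\<lambda>t. sym_diff a t"])
        (use a b in \<open>auto\<close>)
    also have "\<dots> = (\<Sum>c\<in>?N. of_bool (sym_diff a c \<subseteq> b) * bw_op g v c)"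
      by (intro sum.mono_neutral_cong_left) auto
    also have "\<dots> = (\<Sum>c\<in>?N. \<Sum>d\<in>?N. \<Sum>e\<in>?N.
        of_bool (d \<subseteq> e \<and> e - d \<subseteq> sym_diff a c \<and> sym_diff a c \<subseteq> b) * m_coeff g c d * ?D e)"
    proof (intro sum.cong refl)
      fix c assume c: "c \<in> ?N"
      have ac: "sym_diff a c \<subseteq> {1..n}" "sym_diff a (sym_diff a c) = c" using a c by auto
      have "bw_op g v c = (\<Sum>d\<in>?N. m_coeff g c d *
          (\<Sum>e\<in>?N. of_bool (d \<subseteq> e \<and> e - d \<subseteq> sym_diff a c) * ?D e))"
        using c bderiv_translate[OF ac(1), of _ v a] unfolding ac(2)
        by (subst bw_op_m_coeff[OF g]) (auto intro!: sum.cong)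
      then show "of_bool (sym_diff a c \<subseteq> b) * bw_op g v c = (\<Sum>d\<in>?N. \<Sum>e\<in>?N.
          of_bool (d \<subseteq> e \<and> e - d \<subseteq> sym_diff a c \<and> sym_diff a c \<subseteq> b) * m_coeff g c d * ?D e)"
        by (simp only: sum_distrib_left of_bool_conj mult_ac)
    qed
    finally show ?thesis .
  qed
  have "bw_op (f \<otimes>\<^bsub>BW n\<^esub> g) v a = (\<Sum>b\<in>?N. m_coeff f a b * bderiv b (bw_op g v) a)"
    unfolding bw_op_mult[OF f g] by (rule bw_op_m_coeff[OF f a])
  also have "\<dots> = (\<Sum>b\<in>?N. \<Sum>c\<in>?N. \<Sum>d\<in>?N. \<Sum>e\<in>?N.
      of_bool (d \<subseteq> e \<and> e - d \<subseteq> sym_diff a c \<and> sym_diff a c \<subseteq> b)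
        * (m_coeff f a b * m_coeff g c d) * ?D e)"
    by (intro sum.cong refl) (simp only: bderiv_op_g sum_distrib_left mult_ac)
  also have "\<dots> = (\<Sum>e\<in>?N. \<Sum>b\<in>?N. \<Sum>c\<in>?N. \<Sum>d\<in>?N.
      of_bool (d \<subseteq> e \<and> e - d \<subseteq> sym_diff a c \<and> sym_diff a c \<subseteq> b)
        * (m_coeff f a b * m_coeff g c d) * ?D e)"
    by (rule sum_swap_triple)
  finally show "bw_op (f \<otimes>\<^bsub>BW n\<^esub> g) v a = (\<Sum>e\<in>?N. (\<Sum>b\<in>?N. \<Sum>c\<in>?N. \<Sum>d\<in>?N.
      of_bool (d \<subseteq> e \<and> e - d \<subseteq> sym_diff a c \<and> sym_diff a c \<subseteq> b)
        * (m_coeff f a b * m_coeff g c d)) * ?D e)"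
    by (simp only: sum_distrib_right)
qed

lemma gamma_eq_sum:
  assumes "finite b"
  shows "gamma a b c d e h =
    (\<Sum>k\<in>nested_pairs (b \<inter> c). of_bool (e = a \<union> (c - snd k) \<and> b - fst k = h - d))"
proof -
  have fin: "finite (nested_pairs (b \<inter> c))" using assms by simp
  have "{(k1, k2). k1 \<subseteq> k2 \<and> k2 \<subseteq> b \<inter> c \<and> a \<union> (c - k2) = e \<and> b - k1 = h - d} =
    {k \<in> nested_pairs (b \<inter> c). e = a \<union> (c - snd k) \<and> b - fst k = h - d}"
    by (auto simp: nested_pairs_def)
  then have "gamma a b c d e h =
      (\<Sum>k | k \<in> nested_pairs (b \<inter> c) \<and> e = a \<union> (c - snd k) \<and> b - fst k = h - d. 1)"
    unfolding gamma_def by (simp only:) (intro parity_eq_sum, use fin in simp)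
  also have "\<dots> = (\<Sum>k\<in>nested_pairs (b \<inter> c). of_bool (e = a \<union> (c - snd k) \<and> b - fst k = h - d))"
    using fin by (intro sum.mono_neutral_cong_left) auto
  finally show ?thesis .
qed

text \<open>
  The product of two basis elements, as an operator. After the Leibniz rule the term of a pair \<open>k\<close> is
  \<open>x\<^sup>e y\<^sup>h\<close> with \<open>e = a \<union> (c - k2)\<close> and \<open>h = (b - k1) \<union> d\<close>, or vanishes when \<open>b - k1\<close> meets \<open>d\<close>. Equivalently,
  \<open>d \<subseteq> h\<close> and \<open>b - k1 = h - d\<close>, so grouping the pairs by \<open>(e, h)\<close> counts them as \<^const>\<open>gamma\<close> does.
\<close>

lemma x_basis_product:
  assumes a: "a \<subseteq> {1..n::nat}" and b: "b \<subseteq> {1..n}" and c: "c \<subseteq> {1..n}" and d: "d \<subseteq> {1..n}"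
  shows "of_bool (a \<subseteq> s) * bderiv b (\<lambda>r. of_bool (c \<subseteq> r) * bderiv d v r) s =
    (\<Sum>e\<in>Pow {1..n}. \<Sum>h\<in>Pow {1..n}. of_bool (a \<subseteq> e \<and> d \<subseteq> h) * gamma a b c d e h
      * (of_bool (e \<subseteq> s) * bderiv h v s))"
proof -
  let ?N = "Pow {1..n}" and ?K = "nested_pairs (b \<inter> c)"
  note fin = finite_subset_interval[OF b] finite_subset_interval[OF d]
  have "of_bool (a \<subseteq> s) * bderiv b (\<lambda>r. of_bool (c \<subseteq> r) * bderiv d v r) s =
      (\<Sum>k\<in>?K. of_bool (a \<union> (c - snd k) \<subseteq> s) *
        (of_bool ((b - fst k) \<inter> d = {}) * bderiv ((b - fst k) \<union> d) v s))"
    unfolding bderiv_leibniz[OF fin(1)] sum_distrib_left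
    by (intro sum.cong refl) (simp add: bderiv_bderiv fin of_bool_conj mult.assoc)
  also have "\<dots> = (\<Sum>k\<in>?K. \<Sum>e\<in>?N. of_bool (a \<subseteq> e \<and> e = a \<union> (c - snd k)) * (of_bool (e \<subseteq> s) *
      (\<Sum>h\<in>?N. of_bool (d \<subseteq> h \<and> b - fst k = h - d) * bderiv h v s)))"
  proof (intro sum.cong refl)
    fix k :: "nat set \<times> nat set"
    have h: "(\<Sum>h\<in>?N. of_bool (d \<subseteq> h \<and> b - fst k = h - d) * bderiv h v s) =
        of_bool ((b - fst k) \<inter> d = {}) * bderiv ((b - fst k) \<union> d) v s"
      using b d by (intro sum_of_bool_eq_point) auto
    have e: "(\<Sum>e\<in>?N. of_bool (a \<subseteq> e \<and> e = a \<union> (c - snd k)) * (of_bool (e \<subseteq> s) * z)) =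
        of_bool True * (of_bool (a \<union> (c - snd k) \<subseteq> s) * z)" for z :: bit
      by (rule sum_of_bool_eq_point[where F = "\<lambda>e. of_bool (e \<subseteq> s) * z" and Q = True])
        (use a c in auto)
    show "of_bool (a \<union> (c - snd k) \<subseteq> s) *
        (of_bool ((b - fst k) \<inter> d = {}) * bderiv ((b - fst k) \<union> d) v s) =
      (\<Sum>e\<in>?N. of_bool (a \<subseteq> e \<and> e = a \<union> (c - snd k)) * (of_bool (e \<subseteq> s) *
        (\<Sum>h\<in>?N. of_bool (d \<subseteq> h \<and> b - fst k = h - d) * bderiv h v s)))"
      unfolding h e by simp
  qed
  also have "\<dots> = (\<Sum>e\<in>?N. \<Sum>h\<in>?N. \<Sum>k\<in>?K. of_bool (a \<subseteq> e \<and> e = a \<union> (c - snd k)) * (of_bool (e \<subseteq> s) *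
      (of_bool (d \<subseteq> h \<and> b - fst k = h - d) * bderiv h v s)))"
    unfolding sum_distrib_left
    by (subst sum.swap, intro sum.cong refl) (rule sum.swap)
  also have "\<dots> = (\<Sum>e\<in>?N. \<Sum>h\<in>?N. of_bool (a \<subseteq> e \<and> d \<subseteq> h) * gamma a b c d e h
      * (of_bool (e \<subseteq> s) * bderiv h v s))"
    unfolding gamma_eq_sum[OF fin(1)] sum_distrib_left sum_distrib_right of_bool_conj
    by (intro sum.cong refl) (simp only: mult_ac)
  finally show ?thesis .
qed

lemma x_coeff_mult:
  assumes f: "f \<in> carrier (BW n)" and g: "g \<in> carrier (BW n)"
    and e: "e \<subseteq> {1..n}" and h: "h \<subseteq> {1..n}"
  shows "x_coeff (f \<otimes>\<^bsub>BW n\<^esub> g) e h =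
    (\<Sum>a\<in>Pow {1..n}. \<Sum>b\<in>Pow {1..n}. \<Sum>c\<in>Pow {1..n}. \<Sum>d\<in>Pow {1..n}.
      of_bool (a \<subseteq> e \<and> d \<subseteq> h) * (gamma a b c d e h * x_coeff f a b * x_coeff g c d))"
proof (rule x_coeff_unique[OF _ e h])
  fix v :: "nat set \<Rightarrow> bit" and s :: "nat set"
  let ?N = "Pow {1..n}"
  let ?F = "x_coeff f" and ?G = "x_coeff g"
  have op_f: "bw_op f w s = (\<Sum>a\<in>?N. \<Sum>b\<in>?N. ?F a b * (of_bool (a \<subseteq> s) * bderiv b w s))" for w
    by (subst bw_eq_x_comb[OF f]) (rule bw_op_x_comb)
  have op_g: "bw_op g v = (\<lambda>r. \<Sum>c\<in>?N. \<Sum>d\<in>?N. ?G c d * (of_bool (c \<subseteq> r) * bderiv d v r))"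
    by (subst bw_eq_x_comb[OF g]) (rule ext, rule bw_op_x_comb)
  \<comment> \<open>The outer of the two sums in \<open>op_g\<close> carries no coefficient, so it needs its own form of linearity.\<close>
  have bderiv_sum': "bderiv b (\<lambda>r. \<Sum>c\<in>I. w c r) s = (\<Sum>c\<in>I. bderiv b (w c) s)"
    for b I and w :: "nat set \<Rightarrow> nat set \<Rightarrow> bit"
    using bderiv_sum[where k = "\<lambda>_. 1" and w = w] by simp
  have bderiv_op_g: "bderiv b (bw_op g v) s =
      (\<Sum>c\<in>?N. \<Sum>d\<in>?N. ?G c d * bderiv b (\<lambda>r. of_bool (c \<subseteq> r) * bderiv d v r) s)" for b
    unfolding op_g
      bderiv_sum'[where w = "\<lambda>c r. \<Sum>d\<in>?N. ?G c d * (of_bool (c \<subseteq> r) * bderiv d v r)"]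
    by (simp only: bderiv_sum)
  have "bw_op (f \<otimes>\<^bsub>BW n\<^esub> g) v s = (\<Sum>a\<in>?N. \<Sum>b\<in>?N. \<Sum>c\<in>?N. \<Sum>d\<in>?N.
      ?F a b * (?G c d * (of_bool (a \<subseteq> s) * bderiv b (\<lambda>r. of_bool (c \<subseteq> r) * bderiv d v r) s)))"
    unfolding bw_op_mult[OF f g] op_f bderiv_op_g sum_distrib_left
    by (intro sum.cong refl) (simp only: mult_ac)
  also have "\<dots> = (\<Sum>a\<in>?N. \<Sum>b\<in>?N. \<Sum>c\<in>?N. \<Sum>d\<in>?N. \<Sum>e\<in>?N. \<Sum>h\<in>?N.
      of_bool (a \<subseteq> e \<and> d \<subseteq> h) * (gamma a b c d e h * ?F a b * ?G c d)
        * (of_bool (e \<subseteq> s) * bderiv h v s))"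
    by (intro sum.cong refl, simp only: Pow_iff x_basis_product sum_distrib_left) (simp only: mult_ac)
  also have "\<dots> = (\<Sum>e\<in>?N. \<Sum>h\<in>?N. \<Sum>a\<in>?N. \<Sum>b\<in>?N. \<Sum>c\<in>?N. \<Sum>d\<in>?N.
      of_bool (a \<subseteq> e \<and> d \<subseteq> h) * (gamma a b c d e h * ?F a b * ?G c d)
        * (of_bool (e \<subseteq> s) * bderiv h v s))"
    by (rule sum_swap_quadruple)
  finally show "bw_op (f \<otimes>\<^bsub>BW n\<^esub> g) v s = (\<Sum>e\<in>?N. \<Sum>h\<in>?N. (\<Sum>a\<in>?N. \<Sum>b\<in>?N. \<Sum>c\<in>?N. \<Sum>d\<in>?N.
      of_bool (a \<subseteq> e \<and> d \<subseteq> h) * (gamma a b c d e h * ?F a b * ?G c d))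
        * (of_bool (e \<subseteq> s) * bderiv h v s))"
    by (simp only: sum_distrib_right)
qed


text \<open>
  On subsets of \<open>{1..n}\<close> both coordinate functions agree with the explicit coefficients, whose product
  formulas differ from the claim only in writing the summation conditions as factors.
\<close>

theorem theorem17:
  fixes n :: nat and f g :: "free_poly set" and a e h :: "nat set"
  assumes "n \<ge> 1"
    and "f \<in> carrier (BW n)" and "g \<in> carrier (BW n)"
    and "a \<subseteq> {1..n}" and "e \<subseteq> {1..n}" and "h \<subseteq> {1..n}"
  shows "m_coord n (f \<otimes>\<^bsub>BW n\<^esub> g) a e =
      (\<Sum>(b, c, d) \<in> {(b, c, d). b \<subseteq> {1..n} \<and> c \<subseteq> {1..n} \<and> d \<subseteq> {1..n} \<and>
           d \<subseteq> e \<and> e - d \<subseteq> sym_diff a c \<and> sym_diff a c \<subseteq> b}.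
         m_coord n f a b * m_coord n g c d)
    \<and> x_coord n (f \<otimes>\<^bsub>BW n\<^esub> g) e h =
      (\<Sum>(a, b, c, d) \<in> {(a, b, c, d). a \<subseteq> {1..n} \<and> b \<subseteq> {1..n} \<and> c \<subseteq> {1..n} \<and> d \<subseteq> {1..n} \<and>
           a \<subseteq> e \<and> d \<subseteq> h}.
         gamma a b c d e h * x_coord n f a b * x_coord n g c d)"
proof
  let ?N = "Pow {1..n}"
  note f = assms(2) and g = assms(3) and a = assms(4) and e = assms(5) and h = assms(6)
  interpret ring "BW n" by (rule ring_BW)
  have fg: "f \<otimes>\<^bsub>BW n\<^esub> g \<in> carrier (BW n)" using f g by (rule m_closed)
  have "m_coord n (f \<otimes>\<^bsub>BW n\<^esub> g) a e = (\<Sum>(b, c, d)\<in>?N \<times> ?N \<times> ?N.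
      of_bool (d \<subseteq> e \<and> e - d \<subseteq> sym_diff a c \<and> sym_diff a c \<subseteq> b) * (m_coeff f a b * m_coeff g c d))"
    unfolding m_coord_eq_m_coeff[OF fg a e] m_coeff_mult[OF f g a e]
    by (simp only: sum.cartesian_product)
  also have "\<dots> = (\<Sum>(b, c, d) \<in> {(b, c, d). b \<subseteq> {1..n} \<and> c \<subseteq> {1..n} \<and> d \<subseteq> {1..n} \<and>
           d \<subseteq> e \<and> e - d \<subseteq> sym_diff a c \<and> sym_diff a c \<subseteq> b}.
         m_coord n f a b * m_coord n g c d)"
  proof (rule sum.mono_neutral_cong_right)
    fix x assume "x \<in> {(b, c, d). b \<subseteq> {1..n} \<and> c \<subseteq> {1..n} \<and> d \<subseteq> {1..n} \<and>
      d \<subseteq> e \<and> e - d \<subseteq> sym_diff a c \<and> sym_diff a c \<subseteq> b}"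
    then obtain b c d where x: "x = (b, c, d)" "b \<subseteq> {1..n}" "c \<subseteq> {1..n}" "d \<subseteq> {1..n}"
      and P: "d \<subseteq> e \<and> e - d \<subseteq> sym_diff a c \<and> sym_diff a c \<subseteq> b"
      by blast
    show "(case x of (b, c, d) \<Rightarrow>
        of_bool (d \<subseteq> e \<and> e - d \<subseteq> sym_diff a c \<and> sym_diff a c \<subseteq> b) * (m_coeff f a b * m_coeff g c d)) =
      (case x of (b, c, d) \<Rightarrow> m_coord n f a b * m_coord n g c d)"
      unfolding x(1) prod.case m_coord_eq_m_coeff[OF f a x(2)] m_coord_eq_m_coeff[OF g x(3,4)]
      using P by (simp only: of_bool_eq simp_thms mult_1)
  qed auto
  finally show "m_coord n (f \<otimes>\<^bsub>BW n\<^esub> g) a e = \<dots>" .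
  have "x_coord n (f \<otimes>\<^bsub>BW n\<^esub> g) e h = (\<Sum>(a, b, c, d)\<in>?N \<times> ?N \<times> ?N \<times> ?N.
      of_bool (a \<subseteq> e \<and> d \<subseteq> h) * (gamma a b c d e h * x_coeff f a b * x_coeff g c d))"
    unfolding x_coord_eq_x_coeff[OF fg e h] x_coeff_mult[OF f g e h]
    by (simp only: sum.cartesian_product)
  also have "\<dots> = (\<Sum>(a, b, c, d) \<in> {(a, b, c, d). a \<subseteq> {1..n} \<and> b \<subseteq> {1..n} \<and> c \<subseteq> {1..n} \<and> d \<subseteq> {1..n} \<and>
           a \<subseteq> e \<and> d \<subseteq> h}.
         gamma a b c d e h * x_coord n f a b * x_coord n g c d)"
  proof (rule sum.mono_neutral_cong_right)
    fix x assume "x \<in> {(a, b, c, d). a \<subseteq> {1..n} \<and> b \<subseteq> {1..n} \<and> c \<subseteq> {1..n} \<and> d \<subseteq> {1..n} \<and>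
           a \<subseteq> e \<and> d \<subseteq> h}"
    then obtain a b c d where x: "x = (a, b, c, d)" "a \<subseteq> {1..n}" "b \<subseteq> {1..n}" "c \<subseteq> {1..n}" "d \<subseteq> {1..n}"
      and P: "a \<subseteq> e \<and> d \<subseteq> h"
      by blast
    show "(case x of (a, b, c, d) \<Rightarrow>
        of_bool (a \<subseteq> e \<and> d \<subseteq> h) * (gamma a b c d e h * x_coeff f a b * x_coeff g c d)) =
      (case x of (a, b, c, d) \<Rightarrow> gamma a b c d e h * x_coord n f a b * x_coord n g c d)"
      unfolding x(1) prod.case x_coord_eq_x_coeff[OF f x(2,3)] x_coord_eq_x_coeff[OF g x(4,5)]
      using P by (simp only: of_bool_eq simp_thms mult_1)
  qed auto
  finally show "x_coord n (f \<otimes>\<^bsub>BW n\<^esub> g) e h = \<dots>" .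
qed

end
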